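(* Let $a>0$ be a constant. The following hold for all sufficiently small constants $\varepsilon>0$; in each, "$Y=(1+O(h))Z$ with probability $1-\tilde{o}(1)$" means there is a constant $C>0$ such that $|Y-Z|\le Ch|Z|$ with probability $1-\tilde{o}(1)$, and similarly for $Y=O(h)Z$. (a) Suppose $(m,n,p)$ and $(m,n,k/(mn))$ are $(a,\varepsilon)$-acceptable. Then, with probability $1-\tilde{o}(1)$, \[ \sum_{i=1}^m(S_i-n\Lambda)^2=\bigl(1+O(n^{-1/2+2\varepsilon})\bigr)\Lambda(1-\Lambda)mn, \] and, with probability $1-\tilde{o}(1)$, \[ \sum_{j=1}^n(T_j-m\Lambda)^2=\bigl(1+O(m^{-1/2+2\varepsilon})\bigr)\Lambda(1-\Lambda)mn, \] when $\mathcal{D}$ is $\mathcal{G}_p$ or $\mathcal{G}_k$; when $m=n$ the same holds for $\mathcal{D}$ being $\vec{\mathcal{G}}_p$ or $\vec{\mathcal{G}}_k$. (b) If $\boldsymbol{t}\in I_m^n$ is $\varepsilon$-regular and $(m,n,\lambda_m(\boldsymbol{t}))$ is $(a,\varepsilon)$-acceptable, then the first of these (the statement about $\sum_i(S_i-n\Lambda)^2$) holds with probability $1-\tilde{o}(1)$ when $\mathcal{D}$ is $\mathcal{G}_{\boldsymbol{t}}$, and, when $m=n$, when $\mathcal{D}$ is $\vec{\mathcal{G}}_{\boldsymbol{t}}$. (c) If $m=n$, $(n,n,p)$, $(n,n,k/n^2)$ and $(n,n,\lambda_n(\boldsymbol{t}))$ are $(a,\varepsilon)$-acceptable and $\boldsymbol{t}\in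 I_n^n$ is $\varepsilon$-regular, then with probability $1-\tilde{o}(1)$, \[ \sum_{i=1}^n(S_i-n\Lambda)(T_i-n\Lambda)=O(n^{-1/2+2\varepsilon})\,\Lambda(1-\Lambda)n^2 \] when $\mathcal{D}$ is $\vec{\mathcal{G}}_p$, $\vec{\mathcal{G}}_k$ or $\vec{\mathcal{G}}_{\boldsymbol{t}}$ (in the last case $\boldsymbol{T}=\boldsymbol{t}$).
   Context: Asymptotics: $m,n,p,k,\boldsymbol{t}$ are functions of an index $\ell\to\infty$; $O,o$ refer to $\ell\to\infty$. $\tilde{o}(1)$ denotes any quantity of magnitude $O(e^{-n^c})$ for some constant $c>0$. $U=\{u_1,\dots,u_m\}$, $V=\{v_1,\dots,v_n\}$; for a bipartite graph on $U\cup V$, $S_i=\deg u_i$, $T_j=\deg v_j$, $K=\sum_iS_i=\sum_jT_j$ (number of edges), $\Lambda=K/(mn)$. $I_n=\{0,\dots,n\}$. Models (random graphs, probabilities written $\operatorname{Prob}_{\mathcal{D}}$): $\mathcal{G}_p$: each of the $mn$ edges $u_iv_j$ present independently with probability $p$; $\vec{\mathcal{G}}_p$ ($m=n$): edges $u_iv_i$ forbidden, the other $n^2-n$ present independently with probability $p$. $\mathcal{G}_k$: uniform over bipartite graphs on $U\cup V$ with $k$ edges; $\vec{\mathcal{G}}_k$: uniform over those with $k$ edges and no edge $u_iv_i$. $\mathcal{G}_{\boldsymbol{t}}$: uniform over bipartite graphs with $\deg v_j=t_j$ for all $j$ (so $\boldsymbol{T}=\boldsymbol{t}$ and $\Lambda=\lambda_m(\boldsymbol{t})$);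 $\vec{\mathcal{G}}_{\boldsymbol{t}}$: same with edges $u_iv_i$ forbidden. $\lambda_m(\boldsymbol{t})=(mn)^{-1}\sum_jt_j$. A vector $(x_1,\dots,x_N)$ is $\varepsilon$-regular if $x_i-\frac1N\sum_jx_j=O(N^{1/2+\varepsilon})$ uniformly in $i$. $(m,n,x)$, $x\in(0,1)$, is $(a,\varepsilon)$-acceptable if $m,n\to\infty$ with $m=o(n^{1+\varepsilon})$, $n=o(m^{1+\varepsilon})$, and $\frac{(1-2x)^2}{4x(1-x)}\bigl(1+\frac{5m}{6n}+\frac{5n}{6m}\bigr)<a\log n$. *)

theory Defs
  imports "HOL-Probability.Probability" "HOL-Library.Landau_Symbols"
begin

text \<open>
  A bipartite graph on \<open>U = {u\<^sub>1,\<dots>,u\<^sub>m}\<close> and \<open>V = {v\<^sub>1,\<dots>,v\<^sub>n}\<close> is encoded by its edge set: the pair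
  \<open>(i, j)\<close> stands for the edge \<open>u\<^sub>i v\<^sub>j\<close>.
\<close>

type_synonym bigraph = "(nat \<times> nat) set"

definition all_edges :: "nat \<Rightarrow> nat \<Rightarrow> (nat \<times> nat) set" where
  "all_edges m n = {1..m} \<times> {1..n}"

definition offdiag_edges :: "nat \<Rightarrow> (nat \<times> nat) set" where
  "offdiag_edges n = {(i, j) \<in> {1..n} \<times> {1..n}. i \<noteq> j}"

definition deg_u :: "bigraph \<Rightarrow> nat \<Rightarrow> nat" where
  "deg_u G i = card {j. (i, j) \<in> G}"

definition deg_v :: "bigraph \<Rightarrow> nat \<Rightarrow> nat" where
  "deg_v G j = card {i. (i, j) \<in> G}"

definition edge_density :: "nat \<Rightarrow> nat \<Rightarrow> bigraph \<Rightarrow> real" where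
  "edge_density m n G = real (card G) / (real m * real n)"

text \<open>
  In the three random graph models, \<open>A\<close> is the set of permitted edges: \<open>all_edges m n\<close> gives
  \<open>\<G>\<^sub>p\<close>, \<open>\<G>\<^sub>k\<close>, \<open>\<G>\<^sub>t\<close>, and \<open>offdiag_edges n\<close> gives the versions without edges \<open>u\<^sub>i v\<^sub>i\<close>.
  The last two distributions are meaningful only if a graph of the required kind exists.
\<close>

definition model_p :: "(nat \<times> nat) set \<Rightarrow> real \<Rightarrow> bigraph pmf" where
  "model_p A p = map_pmf (\<lambda>f. {e \<in> A. f e}) (Pi_pmf A False (\<lambda>_. bernoulli_pmf p))"

definition model_k :: "(nat \<times> nat) set \<Rightarrow> nat \<Rightarrow> bigraph pmf" where
  "model_k A k = pmf_of_set {G. G \<subseteq> A \<and> card G = k}"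

definition model_t :: "(nat \<times> nat) set \<Rightarrow> nat \<Rightarrow> (nat \<Rightarrow> nat) \<Rightarrow> bigraph pmf" where
  "model_t A n t = pmf_of_set {G. G \<subseteq> A \<and> (\<forall>j\<in>{1..n}. deg_v G j = t j)}"

definition lambda_vec :: "nat \<Rightarrow> nat \<Rightarrow> (nat \<Rightarrow> nat) \<Rightarrow> real" where
  "lambda_vec m n t = (\<Sum>j=1..n. real (t j)) / (real m * real n)"

text \<open>Below, all parameters are sequences indexed by \<open>l \<rightarrow> \<infinity>\<close>.\<close>

definition eps_regular :: "real \<Rightarrow> (nat \<Rightarrow> nat) \<Rightarrow> (nat \<Rightarrow> nat \<Rightarrow> real) \<Rightarrow> bool" where
  "eps_regular \<epsilon> N x \<longleftrightarrow>
     (\<exists>C. \<forall>\<^sub>F l in sequentially. \<forall>i\<in>{1..N l}.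
        \<bar>x l i - (\<Sum>j=1..N l. x l j) / real (N l)\<bar> \<le> C * real (N l) powr (1/2 + \<epsilon>))"

definition acceptable ::
  "real \<Rightarrow> real \<Rightarrow> (nat \<Rightarrow> nat) \<Rightarrow> (nat \<Rightarrow> nat) \<Rightarrow> (nat \<Rightarrow> real) \<Rightarrow> bool" where
  "acceptable a \<epsilon> m n x \<longleftrightarrow>
     filterlim m at_top sequentially \<and> filterlim n at_top sequentially \<and>
     (\<lambda>l. real (m l)) \<in> o(\<lambda>l. real (n l) powr (1 + \<epsilon>)) \<and>
     (\<lambda>l. real (n l)) \<in> o(\<lambda>l. real (m l) powr (1 + \<epsilon>)) \<and>
     (\<forall>\<^sub>F l in sequentially. 0 < x l \<and> x l < 1 \<and>
        (1 - 2 * x l)\<^sup>2 / (4 * x l * (1 - x l)) *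
          (1 + 5 * real (m l) / (6 * real (n l)) + 5 * real (n l) / (6 * real (m l)))
        < a * ln (real (n l)))"

text \<open>\<open>f = otilde(1)\<close>, with \<open>otilde\<close> relative to the sequence \<open>n\<close>:\<close>

definition otilde :: "(nat \<Rightarrow> nat) \<Rightarrow> (nat \<Rightarrow> real) \<Rightarrow> bool" where
  "otilde n f \<longleftrightarrow> (\<exists>c>0. f \<in> O(\<lambda>l. exp (- (real (n l) powr c))))"

definition whp :: "(nat \<Rightarrow> nat) \<Rightarrow> (nat \<Rightarrow> bigraph pmf) \<Rightarrow> (nat \<Rightarrow> bigraph \<Rightarrow> bool) \<Rightarrow> bool" where
  "whp n D P \<longleftrightarrow> otilde n (\<lambda>l. 1 - measure_pmf.prob (D l) {G. P l G})"

text \<open>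
  \<open>U_concentrated\<close>: \<open>\<Sum>\<^sub>i (S\<^sub>i - n\<Lambda>)\<^sup>2 = (1 + O(n\<^bsup>-1/2+2\<epsilon>\<^esup>)) \<Lambda>(1-\<Lambda>)mn\<close> with probability \<open>1 - otilde(1)\<close>;
  \<open>V_concentrated\<close>: \<open>\<Sum>\<^sub>j (T\<^sub>j - m\<Lambda>)\<^sup>2 = (1 + O(m\<^bsup>-1/2+2\<epsilon>\<^esup>)) \<Lambda>(1-\<Lambda>)mn\<close> with probability \<open>1 - otilde(1)\<close>;
  \<open>UV_small\<close>: \<open>\<Sum>\<^sub>i (S\<^sub>i - n\<Lambda>)(T\<^sub>i - n\<Lambda>) = O(n\<^bsup>-1/2+2\<epsilon>\<^esup>) \<Lambda>(1-\<Lambda>)n\<^sup>2\<close> with probability \<open>1 - otilde(1)\<close>.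
\<close>

definition U_dev :: "nat \<Rightarrow> nat \<Rightarrow> bigraph \<Rightarrow> real" where
  "U_dev m n G = (\<Sum>i=1..m. (real (deg_u G i) - real n * edge_density m n G)\<^sup>2)"

definition V_dev :: "nat \<Rightarrow> nat \<Rightarrow> bigraph \<Rightarrow> real" where
  "V_dev m n G = (\<Sum>j=1..n. (real (deg_v G j) - real m * edge_density m n G)\<^sup>2)"

definition UV_dev :: "nat \<Rightarrow> bigraph \<Rightarrow> real" where
  "UV_dev n G = (\<Sum>i=1..n. (real (deg_u G i) - real n * edge_density n n G) *
                           (real (deg_v G i) - real n * edge_density n n G))"

definition var_scale :: "nat \<Rightarrow> nat \<Rightarrow> bigraph \<Rightarrow> real" where
  "var_scale m n G = edge_density m n G * (1 - edge_density m n G) * real m * real n"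

definition U_concentrated ::
  "real \<Rightarrow> (nat \<Rightarrow> nat) \<Rightarrow> (nat \<Rightarrow> nat) \<Rightarrow> (nat \<Rightarrow> bigraph pmf) \<Rightarrow> bool" where
  "U_concentrated \<epsilon> m n D \<longleftrightarrow>
     (\<exists>C>0. whp n D (\<lambda>l G. \<bar>U_dev (m l) (n l) G - var_scale (m l) (n l) G\<bar>
        \<le> C * real (n l) powr (-1/2 + 2*\<epsilon>) * \<bar>var_scale (m l) (n l) G\<bar>))"

definition V_concentrated ::
  "real \<Rightarrow> (nat \<Rightarrow> nat) \<Rightarrow> (nat \<Rightarrow> nat) \<Rightarrow> (nat \<Rightarrow> bigraph pmf) \<Rightarrow> bool" where
  "V_concentrated \<epsilon> m n D \<longleftrightarrow>
     (\<exists>C>0. whp n D (\<lambda>l G. \<bar>V_dev (m l) (n l) G - var_scale (m l) (n l) G\<bar>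
        \<le> C * real (m l) powr (-1/2 + 2*\<epsilon>) * \<bar>var_scale (m l) (n l) G\<bar>))"

definition UV_small :: "real \<Rightarrow> (nat \<Rightarrow> nat) \<Rightarrow> (nat \<Rightarrow> bigraph pmf) \<Rightarrow> bool" where
  "UV_small \<epsilon> n D \<longleftrightarrow>
     (\<exists>C>0. whp n D (\<lambda>l G. \<bar>UV_dev (n l) G\<bar>
        \<le> C * real (n l) powr (-1/2 + 2*\<epsilon>) * \<bar>var_scale (n l) (n l) G\<bar>))"

end

theory Submission
  imports Defs "HOL-Real_Asymp.Real_Asymp"
begin

text \<open>
  In \<open>\<G>\<^sub>t\<close> the columns of the biadjacency matrix are independent uniformly random subsets of prescribed
  size. By Maclaurin's inequality a weighted sum over such a subset, centred, has exponential moments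
  at most those of a Gaussian with variance proportional to the sum of the squared weights. Let
  \<open>W\<^sub>i = S\<^sub>i - \<bbbE> S\<^sub>i\<close>. The sum \<open>\<Sum>\<^sub>i W\<^sub>i\<^sup>2\<close> equals a deterministic term plus twice a martingale whose
  \<open>j\<close>-th increment is a weighted sum over column \<open>j\<close>, the weights being the partial row sums over the
  previous columns. These partial sums are \<open>O(n\<^bsup>1/2+\<epsilon>/4\<^esup>)\<close> except with tiny probability, so clipping
  them changes nothing, and the Chernoff bound concentrates the martingale. The sum
  \<open>\<Sum>\<^sub>i (S\<^sub>i - n\<Lambda>)(t\<^sub>i - n\<Lambda>)\<close> is even linear in the columns.

  A graph in \<open>\<G>\<^sub>p\<close> or \<open>\<G>\<^sub>k\<close> has a weight depending only on its number of edges, so these models are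
  mixtures of models \<open>\<G>\<^sub>t\<close>, and the random vector \<open>T\<close> is \<open>\<epsilon>\<close>-regular with overwhelming probability.
  The statement about the \<open>T\<^sub>j\<close> follows by transposition.
\<close>


subsection \<open>Exponential moments of random subsets\<close>

text \<open>Fixing the column degrees removes two obstacles at once: \<Lambda> becomes a constant
  and the columns become independent, although the entries within a column do not. Maclaurin's
  inequality gives a uniformly random subset the exponential moment bound that independent choices
  would have; applied to the set of all edges it also serves \<open>model_k\<close>. The inequality
  in acceptability is used through one consequence: the density x satisfies x(1 - x) \<ge> const /
  log n. The tail bounds ignore the density and leave errors of order at most n^(1/2 +
  3\<epsilon>/2) m, against a target of n^(1/2 + 2\<epsilon>) m / log n. The spare n^(\<epsilon>/2)
  pays for the logarithm and for every constant, so the O-constants of the conclusion can all be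
  taken to be 1. Forbidding the diagonal shifts the row means and replaces m by n - 1 as column
  height; both effects are of lower order. The bound 1/8 on \<epsilon> is a round value below 1/5,
  which is what the tightest comparison of exponents asks for.\<close>

lemma power_tangent_le:
  fixes x y :: real
  assumes "x \<ge> 0" "y \<ge> 0"
  shows "x ^ Suc t + real (Suc t) * x ^ t * (y - x) \<le> y ^ Suc t"
proof (cases "x = 0")
  case True
  then show ?thesis using assms by (cases t) auto
next
  case False
  then have x: "x > 0" using assms by simp
  \<comment> \<open>Bernoulli's inequality at y/x - 1, rescaled by x^(t + 1), is the tangent line
    inequality; the division is why x = 0 stands apart.\<close>
  have "1 + real (Suc t) * (y / x - 1) \<le> (1 + (y / x - 1)) ^ Suc t"
    using x assms by (intro Bernoulli_inequality) simp
  then have "x ^ Suc t * (1 + real (Suc t) * (y / x - 1)) \<le> x ^ Suc t * (y / x) ^ Suc t"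
    using x by (intro mult_left_mono) auto
  also have "x ^ Suc t * (y / x) ^ Suc t = y ^ Suc t"
    using x by (simp add: power_divide)
  also have "x ^ Suc t * (1 + real (Suc t) * (y / x - 1)) = x ^ Suc t + real (Suc t) * x ^ t * (y - x)"
    using x by (simp add: field_simps)
  finally show ?thesis .
qed

lemma subsets_card_insert:
  assumes "finite A" "a \<notin> A"
  shows "{S. S \<subseteq> insert a A \<and> card S = Suc t}
    = {S. S \<subseteq> A \<and> card S = Suc t} \<union> insert a ` {S. S \<subseteq> A \<and> card S = t}"
    (is "?L = ?R")
proof
  show "?L \<subseteq> ?R"
  proof
    fix S assume S: "S \<in> ?L"
    show "S \<in> ?R"
    proof (cases "a \<in> S")
      case True
      have fin: "finite S" using S assms(1) finite_subset by blast
      have "S = insert a (S - {a})" "S - {a} \<subseteq> A" "card (S - {a}) = t"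
        using S True fin by auto
      then show ?thesis by blast
    next
      case False
      then show ?thesis using S by auto
    qed
  qed
  show "?R \<subseteq> ?L"
  proof
    fix S assume "S \<in> ?R"
    then consider "S \<subseteq> A" "card S = Suc t" | S' where "S = insert a S'" "S' \<subseteq> A" "card S' = t"
      by auto
    then show "S \<in> ?L"
    proof cases
      case 2
      have "finite S'" "a \<notin> S'" using 2 assms finite_subset by blast+
      then show ?thesis using 2 by auto
    qed auto
  qed
qed

text \<open>Maclaurin's inequality. Adjoining one element changes the mean, and the change in the
  elementary symmetric polynomial is exactly the tangent line at the old mean.\<close>

lemma elementary_symmetric_le_mean_power:
  fixes x :: "'a \<Rightarrow> real"
  assumes "finite A" "\<And>i. i \<in> A \<Longrightarrow> x i \<ge> 0"
  shows "(\<Sum>S | S \<subseteq> A \<and> card S = t. \<Prod>i\<in>S. x i)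
    \<le> real (card A choose t) * ((\<Sum>i\<in>A. x i) / real (card A)) ^ t"
  using assms
proof (induction A arbitrary: t rule: finite_induct)
  case empty
  have "{S. S = {} \<and> card S = t} = (if t = 0 then {{}} else ({} :: 'a set set))" by auto
  then show ?case by simp
next
  case (insert a A)
  show ?case
  proof (cases t)
    case 0
    have "{S. S \<subseteq> insert a A \<and> card S = 0} = {{}}"
      using insert.hyps(1) finite_subset by fastforce
    then show ?thesis using 0 by simp
  next
    case (Suc u)
    define r where "r = card A"
    define mu where "mu = (\<Sum>i\<in>A. x i) / real r"
    define nu where "nu = (\<Sum>i\<in>insert a A. x i) / real (Suc r)"
    have x0: "x a \<ge> 0" "\<And>i. i \<in> A \<Longrightarrow> x i \<ge> 0" using insert.prems by auto
    have mu0: "mu \<ge> 0" unfolding mu_def using x0 by (intro divide_nonneg_nonneg sum_nonneg) auto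
    have nu0: "nu \<ge> 0" unfolding nu_def
      using x0 insert.hyps by (intro divide_nonneg_nonneg sum_nonneg) auto
    \<comment> \<open>For empty A the quotient \<open>mu\<close> is 0 / 0 = 0, and the identity
      still holds.\<close>
    have sumA: "(\<Sum>i\<in>A. x i) = real r * mu"
      using insert.hyps(1) by (cases "A = {}") (auto simp: mu_def r_def)
    have nu: "real (Suc r) * (nu - mu) = x a - mu"
    proof -
      have "real (Suc r) * nu = x a + real r * mu"
        using insert.hyps sumA unfolding nu_def by simp
      then show ?thesis by (simp add: algebra_simps)
    qed
    have fin: "finite {S. S \<subseteq> A \<and> P S}" for P
      using insert.hyps(1) by simp
    have disj: "{S. S \<subseteq> A \<and> card S = Suc u} \<inter> insert a ` {S. S \<subseteq> A \<and> card S = u} = {}"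
      using insert.hyps(2) by auto
    have inj: "inj_on (insert a) {S. S \<subseteq> A \<and> card S = u}"
      using insert.hyps(2) by (auto simp: inj_on_def)
    have prod_ins: "(\<Prod>i\<in>insert a S. x i) = x a * (\<Prod>i\<in>S. x i)" if "S \<subseteq> A" for S
      using that insert.hyps finite_subset by (subst prod.insert) auto
    have IH: "(\<Sum>S | S \<subseteq> A \<and> card S = v. \<Prod>i\<in>S. x i) \<le> real (r choose v) * mu ^ v" for v
      using insert.IH[of v] x0 by (simp add: mu_def r_def)
    have "(\<Sum>S | S \<subseteq> insert a A \<and> card S = Suc u. \<Prod>i\<in>S. x i)
        = (\<Sum>S | S \<subseteq> A \<and> card S = Suc u. \<Prod>i\<in>S. x i)
          + x a * (\<Sum>S | S \<subseteq> A \<and> card S = u. \<Prod>i\<in>S. x i)"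
      using fin disj inj prod_ins
      by (simp add: subsets_card_insert[OF insert.hyps] sum.union_disjoint sum.reindex sum_distrib_left)
    also have "\<dots> \<le> real (r choose Suc u) * mu ^ Suc u + x a * (real (r choose u) * mu ^ u)"
      by (intro add_mono mult_left_mono IH x0)
    also have "\<dots> = real (Suc r choose Suc u) * mu ^ Suc u + real (r choose u) * mu ^ u * (x a - mu)"
      by (simp add: algebra_simps)
    also have "\<dots> = real (Suc r choose Suc u) * mu ^ Suc u
        + (real (Suc r) * real (r choose u)) * mu ^ u * (nu - mu)"
      unfolding nu[symmetric] by (simp only: mult_ac)
    \<comment> \<open>The absorption identity makes the coefficient of \<open>nu - mu\<close> the
      derivative of the bounding term at \<open>mu\<close>.\<close>
    also have "real (Suc r) * real (r choose u) = real (Suc r choose Suc u) * real (Suc u)"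
      using Suc_times_binomial_eq[of r u] by (metis of_nat_mult)
    also have "real (Suc r choose Suc u) * mu ^ Suc u
        + (real (Suc r choose Suc u) * real (Suc u)) * mu ^ u * (nu - mu)
        = real (Suc r choose Suc u) * (mu ^ Suc u + real (Suc u) * mu ^ u * (nu - mu))"
      by (simp only: algebra_simps)
    also have "\<dots> \<le> real (Suc r choose Suc u) * nu ^ Suc u"
      using power_tangent_le[OF mu0 nu0] by (intro mult_left_mono) auto
    finally show ?thesis
      using insert.hyps unfolding Suc nu_def r_def by simp
  qed
qed

text \<open>Maclaurin bounds the expectation by the t-th power of the mean, and mu \<le> exp (mu -
  1) brings it to the shape of a Poisson generating function. Independent inclusion with probability
  t / card A obeys the same bound, so \<open>model_k\<close> and \<open>model_p\<close> can later be
  treated alike.\<close>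

lemma expectation_prod_random_subset_le:
  fixes x :: "'a \<Rightarrow> real"
  assumes A: "finite A" "t \<le> card A" and x: "\<And>i. i \<in> A \<Longrightarrow> x i \<ge> 0"
  shows "measure_pmf.expectation (pmf_of_set {S. S \<subseteq> A \<and> card S = t}) (\<lambda>S. \<Prod>i\<in>S. x i)
    \<le> exp (real t / real (card A) * (\<Sum>i\<in>A. x i - 1))"
proof (cases "A = {}")
  case True
  then have "t = 0" using A by simp
  then have "{S. S \<subseteq> A \<and> card S = t} = {{}}" using True by auto
  then show ?thesis using True by (simp add: pmf_of_set_singleton)
next
  case False
  define r where "r = card A"
  have r: "r > 0" using False A unfolding r_def by (simp add: card_gt_0_iff)
  define mu where "mu = (\<Sum>i\<in>A. x i) / real r"
  have mu0: "mu \<ge> 0" unfolding mu_def using x by (intro divide_nonneg_nonneg sum_nonneg) auto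
  let ?\<Omega> = "{S. S \<subseteq> A \<and> card S = t}"
  have card: "card ?\<Omega> = (r choose t)" using n_subsets[OF A(1)] by (simp add: r_def)
  have pos: "r choose t > 0" using A by (simp add: r_def)
  have fin: "finite ?\<Omega>" using A(1) by simp
  have ne: "?\<Omega> \<noteq> {}" using card pos by (metis card.empty less_irrefl)
  have "measure_pmf.expectation (pmf_of_set ?\<Omega>) (\<lambda>S. \<Prod>i\<in>S. x i)
      = (\<Sum>S\<in>?\<Omega>. \<Prod>i\<in>S. x i) / real (r choose t)"
    using integral_pmf_of_set[OF ne fin] card by simp
  also have "\<dots> \<le> mu ^ t"
    using elementary_symmetric_le_mean_power[OF A(1) x, where t = t] pos
    by (simp add: mu_def r_def divide_le_eq mult.commute)
  also have "\<dots> \<le> exp (mu - 1) ^ t"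
    using exp_ge_add_one_self[of "mu - 1"] mu0 by (intro power_mono) auto
  also have "\<dots> = exp (real t * (mu - 1))"
    by (simp add: exp_of_nat_mult)
  also have "real t * (mu - 1) = real t / real r * (\<Sum>i\<in>A. x i - 1)"
    using r by (simp add: mu_def sum_subtractf field_simps flip: r_def)
  finally show ?thesis by (simp add: r_def)
qed

lemma exp_le_quadratic:
  fixes x :: real
  assumes "\<bar>x\<bar> \<le> 1"
  shows "exp x \<le> 1 + x + x\<^sup>2"
proof (cases "x \<ge> 0")
  case True
  then show ?thesis using assms exp_bound[of x] by simp
next
  case False
  define y where "y = - x"
  have y: "0 \<le> y" "y \<le> 1" using False assms by (auto simp: y_def)
  have "exp x = 1 / exp y" by (simp add: y_def exp_minus field_simps)
  also have "\<dots> \<le> 1 / (1 + y)"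
    using y exp_ge_add_one_self[of y] by (intro divide_left_mono) auto
  also have "\<dots> \<le> 1 - y + y\<^sup>2"
  proof -
    have "(1 - y + y\<^sup>2) * (1 + y) = 1 + y ^ 3"
      by (simp add: algebra_simps power2_eq_square power3_eq_cube)
    then show ?thesis using y by (simp add: divide_le_eq)
  qed
  finally show ?thesis by (simp add: y_def)
qed

text \<open>With x i = exp (d i) in the product bound, the centring removes the linear part and
  leaves p times the sum of exp (d i) - 1 - d i, each term at most (d i)^2. The factor p is then
  bounded by 1.\<close>

lemma mgf_random_subset_le:
  fixes d :: "'a \<Rightarrow> real"
  assumes A: "finite A" "t \<le> card A" and d: "\<And>i. i \<in> A \<Longrightarrow> \<bar>d i\<bar> \<le> 1"
  shows "measure_pmf.expectation (pmf_of_set {S. S \<subseteq> A \<and> card S = t})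
      (\<lambda>S. exp (\<Sum>i\<in>A. (of_bool (i \<in> S) - real t / real (card A)) * d i))
    \<le> exp (\<Sum>i\<in>A. (d i)\<^sup>2)"
proof -
  define p where "p = real t / real (card A)"
  have p: "0 \<le> p" "p \<le> 1"
    using A by (auto simp: p_def divide_le_eq)
  let ?\<Omega> = "{S. S \<subseteq> A \<and> card S = t}"
  have fin: "finite ?\<Omega>" using A(1) by simp
  have "card ?\<Omega> > 0" using n_subsets[OF A(1)] A(2) by simp
  then have ne: "?\<Omega> \<noteq> {}" by (metis card.empty less_irrefl)
  have eq: "exp (\<Sum>i\<in>A. (of_bool (i \<in> S) - p) * d i)
      = exp (- p * (\<Sum>i\<in>A. d i)) * (\<Prod>i\<in>S. exp (d i))" if "S \<in> ?\<Omega>" for S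
  proof -
    have "(\<Sum>i\<in>A. of_bool (i \<in> S) * d i) = (\<Sum>i\<in>S. d i)"
      using that A(1) by (intro sum.mono_neutral_cong_right) auto
    moreover have "finite S" using that A(1) finite_subset by blast
    ultimately show ?thesis
      by (simp add: left_diff_distrib sum_subtractf exp_diff exp_minus field_simps exp_sum
          flip: sum_distrib_left)
  qed
  have "measure_pmf.expectation (pmf_of_set ?\<Omega>)
      (\<lambda>S. exp (\<Sum>i\<in>A. (of_bool (i \<in> S) - p) * d i))
    = measure_pmf.expectation (pmf_of_set ?\<Omega>)
      (\<lambda>S. exp (- p * (\<Sum>i\<in>A. d i)) * (\<Prod>i\<in>S. exp (d i)))"
    using eq fin ne by (intro integral_cong_AE) (auto simp: AE_measure_pmf_iff)
  also have "\<dots> = exp (- p * (\<Sum>i\<in>A. d i)) *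
      measure_pmf.expectation (pmf_of_set ?\<Omega>) (\<lambda>S. \<Prod>i\<in>S. exp (d i))"
    by simp
  also have "\<dots> \<le> exp (- p * (\<Sum>i\<in>A. d i)) * exp (p * (\<Sum>i\<in>A. exp (d i) - 1))"
    using expectation_prod_random_subset_le[OF A, of "\<lambda>i. exp (d i)"]
    by (intro mult_left_mono) (auto simp: p_def)
  also have "\<dots> = exp (p * (\<Sum>i\<in>A. exp (d i) - 1 - d i))"
    by (simp add: sum_subtractf sum.distrib algebra_simps flip: exp_add)
  also have "\<dots> \<le> exp (1 * (\<Sum>i\<in>A. (d i)\<^sup>2))"
  proof -
    have "p * (\<Sum>i\<in>A. exp (d i) - 1 - d i) \<le> p * (\<Sum>i\<in>A. (d i)\<^sup>2)"
      using p exp_le_quadratic[OF d] by (intro mult_left_mono sum_mono) (auto simp: algebra_simps)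
    also have "\<dots> \<le> 1 * (\<Sum>i\<in>A. (d i)\<^sup>2)"
      using p by (intro mult_right_mono sum_nonneg) auto
    finally show ?thesis by simp
  qed
  finally show ?thesis by (simp add: p_def)
qed

subsection \<open>Independent random columns\<close>

lemma chernoff_pmf:
  fixes Y :: "'a \<Rightarrow> real"
  assumes fin: "finite (set_pmf P)" and \<theta>: "\<theta> \<ge> 0"
    and M: "measure_pmf.expectation P (\<lambda>x. exp (\<theta> * Y x)) \<le> M"
  shows "measure_pmf.prob P {x. Y x > y} \<le> M * exp (- \<theta> * y)"
proof -
  have "measure_pmf.prob P {x. Y x > y} = measure_pmf.expectation P (indicator {x. Y x > y})"
    by simp
  also have "\<dots> \<le> measure_pmf.expectation P (\<lambda>x. exp (\<theta> * Y x) * exp (- \<theta> * y))"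
  proof (intro integral_mono integrable_measure_pmf_finite fin)
    fix x
    show "indicator {x. Y x > y} x \<le> exp (\<theta> * Y x) * exp (- \<theta> * y)"
    proof (cases "Y x > y")
      case True
      then have "0 \<le> \<theta> * Y x - \<theta> * y"
        using \<theta> by (simp add: mult_left_mono)
      then show ?thesis using True by (simp flip: exp_add)
    qed simp
  qed
  also have "\<dots> = measure_pmf.expectation P (\<lambda>x. exp (\<theta> * Y x)) * exp (- \<theta> * y)"
    by simp
  also have "\<dots> \<le> M * exp (- \<theta> * y)"
    using M by (intro mult_right_mono) auto
  finally show ?thesis .
qed

lemma chernoff_abs_pmf:
  fixes Y :: "'a \<Rightarrow> real"
  assumes fin: "finite (set_pmf P)" and \<theta>: "\<theta> \<ge> 0"
    and M: "measure_pmf.expectation P (\<lambda>x. exp (\<theta> * Y x)) \<le> M"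
      "measure_pmf.expectation P (\<lambda>x. exp (- \<theta> * Y x)) \<le> M"
  shows "measure_pmf.prob P {x. \<bar>Y x\<bar> > y} \<le> 2 * M * exp (- \<theta> * y)"
proof -
  have "measure_pmf.prob P {x. \<bar>Y x\<bar> > y}
      \<le> measure_pmf.prob P ({x. Y x > y} \<union> {x. - Y x > y})"
    by (intro measure_pmf.finite_measure_mono) auto
  also have "\<dots> \<le> measure_pmf.prob P {x. Y x > y} + measure_pmf.prob P {x. - Y x > y}"
    by (rule measure_Un_le) auto
  also have "\<dots> \<le> M * exp (- \<theta> * y) + M * exp (- \<theta> * y)"
    using M by (intro add_mono chernoff_pmf fin \<theta>) simp_all
  finally show ?thesis by simp
qed

text \<open>\<open>C j\<close> is the set of rows permitted in column \<open>j\<close>.\<close>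

definition random_columns :: "(nat \<Rightarrow> 'a set) \<Rightarrow> (nat \<Rightarrow> nat) \<Rightarrow> nat \<Rightarrow> (nat \<Rightarrow> 'a set) pmf" where
  "random_columns C t n = Pi_pmf {1..n} {} (\<lambda>j. pmf_of_set {S. S \<subseteq> C j \<and> card S = t j})"

definition centred_sum ::
  "(nat \<Rightarrow> 'a set) \<Rightarrow> (nat \<Rightarrow> nat) \<Rightarrow> nat \<Rightarrow> 'a set \<Rightarrow> ('a \<Rightarrow> real) \<Rightarrow> real" where
  "centred_sum C t j S d
     = (\<Sum>i\<in>C j. (of_bool (i \<in> S) - real (t j) / real (card (C j))) * d i)"

lemma centred_sum_scale: "centred_sum C t j S (\<lambda>i. c * d i) = c * centred_sum C t j S d"
  by (simp add: centred_sum_def sum_distrib_left algebra_simps)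

lemma subsets_card_nonempty:
  assumes "finite A" "t \<le> card A"
  shows "finite {S. S \<subseteq> A \<and> card S = t}" "{S. S \<subseteq> A \<and> card S = t} \<noteq> {}"
  using assms obtain_subset_with_card_n[OF assms(2)] by auto

lemma set_random_columns:
  assumes "\<And>j. j \<in> {1..n} \<Longrightarrow> finite (C j) \<and> t j \<le> card (C j)"
  shows "set_pmf (random_columns C t n) = PiE_dflt {1..n} {} (\<lambda>j. {S. S \<subseteq> C j \<and> card S = t j})"
proof -
  have "set_pmf (pmf_of_set {S. S \<subseteq> C j \<and> card S = t j}) = {S. S \<subseteq> C j \<and> card S = t j}"
    if "j \<in> {1..n}" for j
    using assms[OF that] subsets_card_nonempty[of "C j" "t j"] by (intro set_pmf_of_set) auto
  then show ?thesis
    unfolding random_columns_def by (simp add: set_Pi_pmf PiE_dflt_def)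
qed

lemma random_columnsD:
  assumes "f \<in> set_pmf (random_columns C t n)" "j \<in> {1..n}"
    "\<And>j. j \<in> {1..n} \<Longrightarrow> finite (C j) \<and> t j \<le> card (C j)"
  shows "f j \<subseteq> C j" "card (f j) = t j"
proof -
  have "set_pmf (random_columns C t n) = PiE_dflt {1..n} {} (\<lambda>j. {S. S \<subseteq> C j \<and> card S = t j})"
    by (rule set_random_columns) (fact assms(3))
  then have "f \<in> PiE_dflt {1..n} {} (\<lambda>j. {S. S \<subseteq> C j \<and> card S = t j})"
    using assms(1) by blast
  then show "f j \<subseteq> C j" "card (f j) = t j" using assms(2) by (auto simp: PiE_dflt_def)
qed

lemma finite_set_random_columns:
  assumes "\<And>j. j \<in> {1..n} \<Longrightarrow> finite (C j) \<and> t j \<le> card (C j)"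
  shows "finite (set_pmf (random_columns C t n))"
  using assms by (subst set_random_columns) (auto intro!: finite_PiE_dflt)

text \<open>Azuma's argument: given the earlier columns, the weights of the last one are fixed, so
  its conditional exponential moment is at most exp v, and the induction multiplies these factors.
  The bounds on the weights are demanded for every f, not just for typical f; this is why the row
  sums have to be clipped before they can serve as weights.\<close>

lemma predictable_mgf_le:
  assumes C: "\<And>j. j \<in> {1..n} \<Longrightarrow> finite (C j) \<and> t j \<le> card (C j)"
    and d: "\<And>j f i. i \<in> C j \<Longrightarrow> \<bar>d j f i\<bar> \<le> 1"
    and v: "\<And>j f. (\<Sum>i\<in>C j. (d j f i)\<^sup>2) \<le> v"
    and predictable: "\<And>j s f S. j \<le> s \<Longrightarrow> d j (f(s := S)) = d j f"
  shows "measure_pmf.expectation (random_columns C t n)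
      (\<lambda>f. exp (\<Sum>j=1..n. centred_sum C t j (f j) (d j f))) \<le> exp (real n * v)"
  using C
proof (induction n)
  case 0
  then show ?case by (simp add: random_columns_def)
next
  case (Suc n)
  let ?R = "random_columns C t n"
  let ?P = "pmf_of_set {S. S \<subseteq> C (Suc n) \<and> card S = t (Suc n)}"
  let ?F = "\<lambda>f. exp (\<Sum>j=1..n. centred_sum C t j (f j) (d j f))"
  let ?G = "\<lambda>f S. exp (centred_sum C t (Suc n) S (d (Suc n) f))"
  have C': "finite (C (Suc n))" "t (Suc n) \<le> card (C (Suc n))" using Suc.prems by auto
  have fin: "finite (set_pmf ?R)" using Suc.prems by (intro finite_set_random_columns) auto
  have finP: "finite (set_pmf ?P)" using subsets_card_nonempty[OF C'] by simp
  \<comment> \<open>The last column is drawn after the earlier ones, which puts the expectation over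
    it inside.\<close>
  have ins: "random_columns C t (Suc n)
      = bind_pmf ?R (\<lambda>f. map_pmf (\<lambda>S. f(Suc n := S)) ?P)"
  proof -
    have "{1..Suc n} = insert (Suc n) {1..n}" by auto
    then show ?thesis unfolding random_columns_def
    by (simp only:, subst Pi_pmf_insert') (simp_all add: map_pmf_def bind_commute_pmf[of ?P])
  qed
  have split: "exp (\<Sum>j=1..Suc n. centred_sum C t j ((f(Suc n := S)) j) (d j (f(Suc n := S))))
      = ?F f * ?G f S" for f S
    by (simp add: predictable exp_add mult.commute)
  have "measure_pmf.expectation (random_columns C t (Suc n))
      (\<lambda>f. exp (\<Sum>j=1..Suc n. centred_sum C t j (f j) (d j f)))
    = (\<Sum>f\<in>set_pmf ?R. pmf ?R f * (?F f * measure_pmf.expectation ?P (?G f)))"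
    unfolding ins
    by (subst pmf_expectation_bind[OF fin], use finP in simp, simp)
       (simp only: integral_map_pmf split integral_mult_right_zero real_scaleR_def)
  also have "\<dots> \<le> (\<Sum>f\<in>set_pmf ?R. pmf ?R f * (?F f * exp v))"
  proof (intro sum_mono mult_left_mono)
    fix f
    have "measure_pmf.expectation ?P (?G f) \<le> exp (\<Sum>i\<in>C (Suc n). (d (Suc n) f i)\<^sup>2)"
      unfolding centred_sum_def using d by (intro mgf_random_subset_le C')
    also have "\<dots> \<le> exp v" using v by simp
    finally show "measure_pmf.expectation ?P (?G f) \<le> exp v" .
  qed auto
  also have "\<dots> = exp v * measure_pmf.expectation ?R ?F"
    by (subst integral_measure_pmf[OF fin]) (auto simp: sum_distrib_left mult_ac)
  also have "\<dots> \<le> exp v * exp (real n * v)"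
    using Suc by (intro mult_left_mono) auto
  finally show ?case by (simp add: algebra_simps exp_add)
qed

lemma predictable_tail:
  fixes d :: "nat \<Rightarrow> (nat \<Rightarrow> 'a set) \<Rightarrow> 'a \<Rightarrow> real"
  assumes C: "\<And>j. j \<in> {1..n} \<Longrightarrow> finite (C j) \<and> t j \<le> card (C j)"
    and d: "\<And>j f i. i \<in> C j \<Longrightarrow> \<bar>d j f i\<bar> \<le> \<beta>"
    and v: "\<And>j f. (\<Sum>i\<in>C j. (d j f i)\<^sup>2) \<le> v" "v > 0"
    and predictable: "\<And>j s f S. j \<le> s \<Longrightarrow> d j (f(s := S)) = d j f"
    and y: "y \<ge> 0" "y * \<beta> \<le> 2 * real n * v" and n: "n > 0"
  shows "measure_pmf.prob (random_columns C t n)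
      {f. \<bar>\<Sum>j=1..n. centred_sum C t j (f j) (d j f)\<bar> > y} \<le> 2 * exp (- y\<^sup>2 / (4 * real n * v))"
proof -
  \<comment> \<open>This \<theta> minimises n \<theta>^2 v - \<theta> y; the hypothesis on y *
    \<beta> keeps the rescaled weights within [-1, 1].\<close>
  define \<theta> where "\<theta> = y / (2 * real n * v)"
  have \<theta>: "\<theta> \<ge> 0" "\<theta> * \<beta> \<le> 1" using y v n by (auto simp: \<theta>_def divide_le_eq)
  have mgf: "measure_pmf.expectation (random_columns C t n)
      (\<lambda>f. exp (c * (\<Sum>j=1..n. centred_sum C t j (f j) (d j f)))) \<le> exp (real n * (\<theta>\<^sup>2 * v))"
    if c: "\<bar>c\<bar> = \<theta>" for c
  proof -
    have c2: "c\<^sup>2 = \<theta>\<^sup>2" using c by (metis power2_abs)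
    have "\<bar>c * d j f i\<bar> \<le> 1" if "i \<in> C j" for j f i
    proof -
      have "\<bar>c * d j f i\<bar> \<le> \<theta> * \<beta>"
        unfolding abs_mult c using d[OF that] \<theta> by (intro mult_left_mono) auto
      then show ?thesis using \<theta> by simp
    qed
    moreover have "(\<Sum>i\<in>C j. (c * d j f i)\<^sup>2) \<le> \<theta>\<^sup>2 * v" for j f
      using v(1)[of j f] by (simp add: power_mult_distrib c2 mult_left_mono flip: sum_distrib_left)
    ultimately have "measure_pmf.expectation (random_columns C t n)
        (\<lambda>f. exp (\<Sum>j=1..n. centred_sum C t j (f j) (\<lambda>i. c * d j f i))) \<le> exp (real n * (\<theta>\<^sup>2 * v))"
      using C predictable by (intro predictable_mgf_le) auto
    then show ?thesis by (simp add: centred_sum_scale sum_distrib_left)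
  qed
  have "measure_pmf.prob (random_columns C t n)
      {f. \<bar>\<Sum>j=1..n. centred_sum C t j (f j) (d j f)\<bar> > y}
    \<le> 2 * exp (real n * (\<theta>\<^sup>2 * v)) * exp (- \<theta> * y)"
    using mgf[of \<theta>] mgf[of "-\<theta>"] \<theta> C by (intro chernoff_abs_pmf finite_set_random_columns) auto
  also have "\<dots> = 2 * exp (real n * (\<theta>\<^sup>2 * v) - \<theta> * y)"
    by (simp add: exp_diff exp_minus field_simps)
  also have "real n * (\<theta>\<^sup>2 * v) - \<theta> * y = - y\<^sup>2 / (4 * real n * v)"
    using v n by (simp add: \<theta>_def field_simps power2_eq_square)
  finally show ?thesis .
qed

subsection \<open>Row sums\<close>

text \<open>The value 0 off the permitted rows lets columns with different permitted sets be summed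
  over one common set of rows.\<close>

definition centred_entry ::
  "(nat \<Rightarrow> 'a set) \<Rightarrow> (nat \<Rightarrow> nat) \<Rightarrow> nat \<Rightarrow> 'a set \<Rightarrow> 'a \<Rightarrow> real" where
  "centred_entry C t j S i
     = (if i \<in> C j then of_bool (i \<in> S) - real (t j) / real (card (C j)) else 0)"

text \<open>For s = n this is a row degree minus its expectation; smaller s are the earlier stages
  of the martingale.\<close>

definition row_dev ::
  "(nat \<Rightarrow> 'a set) \<Rightarrow> (nat \<Rightarrow> nat) \<Rightarrow> nat \<Rightarrow> (nat \<Rightarrow> 'a set) \<Rightarrow> 'a \<Rightarrow> real" where
  "row_dev C t s f i = (\<Sum>j=1..s. centred_entry C t j (f j) i)"

lemma row_dev_upd: "s < k \<Longrightarrow> row_dev C t s (f(k := S)) i = row_dev C t s f i"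
  unfolding row_dev_def by (intro sum.cong) auto

lemma centred_sum_eq_sum_entries:
  assumes "C j \<subseteq> U" "finite U"
  shows "centred_sum C t j S d = (\<Sum>i\<in>U. centred_entry C t j S i * d i)"
  unfolding centred_sum_def
  using assms by (intro sum.mono_neutral_cong_left) (auto simp: centred_entry_def)

text \<open>Each square is expanded as the columns arrive one by one. The diagonal part is
  deterministic by \<open>sum_square_centred_entry\<close>; in the cross terms a new column meets
  only the row sums before it. As j \<ge> 1, the subtraction j - 1 is exact.\<close>

lemma sum_square_row_dev:
  assumes "finite U"
  shows "(\<Sum>i\<in>U. (row_dev C t s f i)\<^sup>2)
    = (\<Sum>j=1..s. \<Sum>i\<in>U. (centred_entry C t j (f j) i)\<^sup>2)
      + 2 * (\<Sum>j=1..s. \<Sum>i\<in>U. centred_entry C t j (f j) i * row_dev C t (j - 1) f i)"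
proof (induction s)
  case 0
  then show ?case by (simp add: row_dev_def)
next
  case (Suc s)
  let ?z = "\<lambda>i. centred_entry C t (Suc s) (f (Suc s)) i"
  have "(\<Sum>i\<in>U. (row_dev C t (Suc s) f i)\<^sup>2)
      = (\<Sum>i\<in>U. (row_dev C t s f i)\<^sup>2 + (?z i)\<^sup>2 + 2 * (?z i * row_dev C t s f i))"
    by (intro sum.cong) (auto simp: row_dev_def power2_sum algebra_simps)
  also have "\<dots> = (\<Sum>i\<in>U. (row_dev C t s f i)\<^sup>2) + (\<Sum>i\<in>U. (?z i)\<^sup>2)
      + 2 * (\<Sum>i\<in>U. ?z i * row_dev C t s f i)"
    by (simp add: sum.distrib sum_distrib_left)
  finally show ?case using Suc.IH by (simp add: algebra_simps)
qed

text \<open>The square of a 0/1 indicator is the indicator itself, so S enters through its size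
  alone, and the size is prescribed.\<close>

lemma sum_square_centred_entry:
  assumes "finite U" "C j \<subseteq> U" "S \<subseteq> C j" "card S = t j" "card (C j) = r" "r > 0"
  shows "(\<Sum>i\<in>U. (centred_entry C t j S i)\<^sup>2) = real (t j) - (real (t j))\<^sup>2 / real r"
proof -
  define p where "p = real (t j) / real r"
  have fin: "finite (C j)" using assms finite_subset by blast
  have "(\<Sum>i\<in>U. (centred_entry C t j S i)\<^sup>2) = (\<Sum>i\<in>C j. (of_bool (i \<in> S) - p)\<^sup>2)"
    using assms by (intro sum.mono_neutral_cong_right) (auto simp: centred_entry_def p_def)
  also have "\<dots> = (\<Sum>i\<in>C j. of_bool (i \<in> S) * (1 - 2 * p) + p\<^sup>2)"
    by (intro sum.cong) (auto simp: power2_eq_square algebra_simps)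
  also have "\<dots> = (\<Sum>i\<in>C j. of_bool (i \<in> S)) * (1 - 2 * p) + real r * p\<^sup>2"
    using assms by (simp add: sum.distrib sum_distrib_right)
  also have "(\<Sum>i\<in>C j. of_bool (i \<in> S)) = real (t j)"
  proof -
    have "C j \<inter> S = S" using assms by blast
    then show ?thesis using fin assms by (simp add: of_bool_def sum.If_cases)
  qed
  also have "real (t j) * (1 - 2 * p) + real r * p\<^sup>2 = real (t j) - (real (t j))\<^sup>2 / real r"
    using assms by (simp add: p_def power2_eq_square field_simps)
  finally show ?thesis .
qed

text \<open>The weight is the indicator of row i in the first s columns, so each column carries
  squared weight at most 1.\<close>

lemma row_dev_tail:
  assumes U: "finite U" "\<And>j. C j \<subseteq> U" and t: "\<And>j. j \<in> {1..n} \<Longrightarrow> t j \<le> card (C j)"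
    and n: "n > 0" and b: "0 \<le> b" "b \<le> 2 * real n" and s: "s \<le> n"
  shows "measure_pmf.prob (random_columns C t n) {f. \<bar>row_dev C t s f i\<bar> > b}
    \<le> 2 * exp (- b\<^sup>2 / (4 * real n))"
proof -
  have finC: "finite (C j)" for j using U finite_subset by blast
  define d :: "nat \<Rightarrow> (nat \<Rightarrow> 'a set) \<Rightarrow> 'a \<Rightarrow> real"
    where "d = (\<lambda>j f k. of_bool (j \<le> s \<and> k = i))"
  have "(\<Sum>k\<in>C j. (d j f k)\<^sup>2) \<le> 1" for j f
  proof -
    have "(\<Sum>k\<in>C j. (d j f k)\<^sup>2) \<le> (\<Sum>k\<in>C j. if k = i then 1 else 0)"
      by (intro sum_mono) (auto simp: d_def)
    also have "\<dots> \<le> 1" using finC by (simp add: sum.delta)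
    finally show ?thesis .
  qed
  then have tail: "measure_pmf.prob (random_columns C t n)
      {f. \<bar>\<Sum>j=1..n. centred_sum C t j (f j) (d j f)\<bar> > b} \<le> 2 * exp (- b\<^sup>2 / (4 * real n * 1))"
    using finC t b n by (intro predictable_tail[where \<beta> = 1]) (auto simp: d_def)
  have "(\<Sum>j=1..n. centred_sum C t j (f j) (d j f)) = row_dev C t s f i" for f
  proof -
    have "centred_sum C t j (f j) (d j f) = (if j \<le> s then centred_entry C t j (f j) i else 0)" for j
    proof -
      \<comment> \<open>Since i is arbitrary, it is adjoined to the row set; its entries vanish
        wherever it is not permitted.\<close>
      have "centred_sum C t j (f j) (d j f)
          = (\<Sum>k\<in>insert i U. centred_entry C t j (f j) k * d j f k)"
        using U by (intro centred_sum_eq_sum_entries) auto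
      also have "\<dots> = (\<Sum>k\<in>insert i U. if k = i then (if j \<le> s then centred_entry C t j (f j) i else 0) else 0)"
        by (intro sum.cong) (auto simp: d_def)
      also have "\<dots> = (if j \<le> s then centred_entry C t j (f j) i else 0)"
        using U(1) by (subst sum.delta) auto
      finally show ?thesis .
    qed
    then have "(\<Sum>j=1..n. centred_sum C t j (f j) (d j f))
        = (\<Sum>j=1..n. if j \<le> s then centred_entry C t j (f j) i else 0)" by simp
    also have "\<dots> = row_dev C t s f i"
      unfolding row_dev_def using s by (intro sum.mono_neutral_cong_right) auto
    finally show ?thesis .
  qed
  then show ?thesis using tail by simp
qed

text \<open>The off-diagonal part of \<open>\<Sum>\<^sub>i W\<^sub>i\<^sup>2\<close> is a sum of martingale differences, linear in the
  newest column with the earlier row sums as weights. Clipping these weights at \<open>b\<close> gives the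
  uniform bound that the exponential moment estimate needs.\<close>

lemma sum_square_row_dev_tail:
  fixes U :: "'a set"
  assumes U: "finite U" "\<And>j. C j \<subseteq> U" "U \<noteq> {}"
    and t: "\<And>j. j \<in> {1..n} \<Longrightarrow> t j \<le> card (C j)"
    and r: "\<And>j. j \<in> {1..n} \<Longrightarrow> card (C j) = r" "r > 0"
    and n: "n > 0" and b: "0 < b" "b \<le> 2 * real n"
    and y: "0 \<le> y" "y \<le> 2 * real n * b * real (card U)"
  shows "measure_pmf.prob (random_columns C t n)
      {f. (\<exists>i\<in>U. \<bar>row_dev C t n f i\<bar> > b) \<or>
          \<bar>(\<Sum>i\<in>U. (row_dev C t n f i)\<^sup>2) - (\<Sum>j=1..n. real (t j) - (real (t j))\<^sup>2 / real r)\<bar> > 2 * y}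
    \<le> 2 * real (card U) * real n * exp (- b\<^sup>2 / (4 * real n))
      + 2 * exp (- y\<^sup>2 / (4 * real n * (b\<^sup>2 * real (card U))))"
proof -
  let ?R = "random_columns C t n"
  have finC: "finite (C j)" for j using U finite_subset by blast
  define clip :: "real \<Rightarrow> real" where "clip x = max (- b) (min b x)" for x
  have clip: "\<bar>clip x\<bar> \<le> b" for x using b by (auto simp: clip_def)
  have clip_id: "clip x = x" if "\<bar>x\<bar> \<le> b" for x using that by (auto simp: clip_def)
  \<comment> \<open>At index 0, where j - 1 truncates, the last factor makes the weight 0 outright,
    so that predictability holds for every j.\<close>
  define d where "d = (\<lambda>j f i. clip (row_dev C t (j - 1) f i) * of_bool (j > 0))"
  let ?Q = "\<lambda>f. \<Sum>j=1..n. centred_sum C t j (f j) (d j f)"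
  have d: "\<bar>d j f i\<bar> \<le> b" for j f i using clip b by (auto simp: d_def)
  have "(\<Sum>i\<in>C j. (d j f i)\<^sup>2) \<le> b\<^sup>2 * real (card U)" for j f
  proof -
    have "(\<Sum>i\<in>C j. (d j f i)\<^sup>2) \<le> (\<Sum>i\<in>C j. b\<^sup>2)"
      using d b by (intro sum_mono) (metis abs_le_square_iff abs_of_pos)
    also have "\<dots> \<le> b\<^sup>2 * real (card U)"
      using card_mono[OF U(1) U(2)[of j]] by (simp add: mult.commute mult_right_mono)
    finally show ?thesis .
  qed
  moreover have "d j (f(s := S)) = d j f" if "j \<le> s" for j s f S
    using that by (cases "j = 0") (auto simp: d_def row_dev_upd)
  moreover have "card U > 0" using U by (simp add: card_gt_0_iff)
  ultimately have Q: "measure_pmf.prob ?R {f. \<bar>?Q f\<bar> > y}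
      \<le> 2 * exp (- y\<^sup>2 / (4 * real n * (b\<^sup>2 * real (card U))))"
    using finC t d b y n
    by (intro predictable_tail[where \<beta> = b])
       (auto simp: power2_eq_square mult_right_mono mult_ac intro: order_trans[OF mult_right_mono])
  let ?W = "\<lambda>s i. {f. \<bar>row_dev C t s f i\<bar> > b}"
  \<comment> \<open>Clipping has to be idle at every stage s and not only at s = n, hence a union
    bound over n * card U events.\<close>
  have W: "measure_pmf.prob ?R (\<Union>(s, i)\<in>{1..n} \<times> U. ?W s i)
      \<le> 2 * real (card U) * real n * exp (- b\<^sup>2 / (4 * real n))"
  proof -
    have "measure_pmf.prob ?R (\<Union>(s, i)\<in>{1..n} \<times> U. ?W s i)
        \<le> (\<Sum>k\<in>{1..n} \<times> U. measure_pmf.prob ?R (case k of (s, i) \<Rightarrow> ?W s i))"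
      using U by (intro measure_pmf.finite_measure_subadditive_finite) auto
    also have "\<dots> \<le> (\<Sum>k\<in>{1..n} \<times> U. 2 * exp (- b\<^sup>2 / (4 * real n)))"
    proof (intro sum_mono)
      fix k assume "k \<in> {1..n} \<times> U"
      then obtain s i where k: "k = (s, i)" "s \<le> n" by auto
      show "measure_pmf.prob ?R (case k of (s, i) \<Rightarrow> ?W s i) \<le> 2 * exp (- b\<^sup>2 / (4 * real n))"
        unfolding k(1) prod.case using b t by (intro row_dev_tail[OF U(1,2) _ n _ _ k(2)]) auto
    qed
    finally show ?thesis by (simp add: card_cartesian_product mult_ac)
  qed
  let ?B = "{f. (\<exists>i\<in>U. \<bar>row_dev C t n f i\<bar> > b) \<or>
      \<bar>(\<Sum>i\<in>U. (row_dev C t n f i)\<^sup>2) - (\<Sum>j=1..n. real (t j) - (real (t j))\<^sup>2 / real r)\<bar> > 2 * y}"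
  \<comment> \<open>On the support the column sizes are the prescribed ones, so the diagonal takes
    its deterministic value; where no row sum exceeds b, the clipped sum is the true cross
    term.\<close>
  have sub: "?B \<inter> set_pmf ?R \<subseteq> (\<Union>(s, i)\<in>{1..n} \<times> U. ?W s i) \<union> {f. \<bar>?Q f\<bar> > y}"
  proof (rule subsetI, rule ccontr)
    fix f assume f: "f \<in> ?B \<inter> set_pmf ?R"
      and nf: "f \<notin> (\<Union>(s, i)\<in>{1..n} \<times> U. ?W s i) \<union> {f. \<bar>?Q f\<bar> > y}"
    have fj: "f j \<subseteq> C j" "card (f j) = t j" if "j \<in> {1..n}" for j
      using f finC t random_columnsD[OF _ that, of f C t] by auto
    have small: "\<bar>row_dev C t s f i\<bar> \<le> b" if "i \<in> U" "s \<le> n" for s i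
    proof (cases "s = 0")
      case True
      then show ?thesis using b by (simp add: row_dev_def)
    next
      case False
      then have "s \<in> {1..n}" using that by auto
      then show ?thesis using nf that by fastforce
    qed
    have "centred_sum C t j (f j) (d j f)
        = (\<Sum>i\<in>U. centred_entry C t j (f j) i * row_dev C t (j - 1) f i)" if "j \<in> {1..n}" for j
      unfolding centred_sum_eq_sum_entries[OF U(2,1)]
    proof (intro sum.cong refl)
      fix i assume "i \<in> U"
      then have "\<bar>row_dev C t (j - 1) f i\<bar> \<le> b" using that by (intro small) auto
      then show "centred_entry C t j (f j) i * d j f i
          = centred_entry C t j (f j) i * row_dev C t (j - 1) f i"
        using that by (simp add: d_def clip_id)
    qed
    then have "?Q f = (\<Sum>j=1..n. \<Sum>i\<in>U. centred_entry C t j (f j) i * row_dev C t (j - 1) f i)"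
      by (intro sum.cong) auto
    moreover have "(\<Sum>j=1..n. \<Sum>i\<in>U. (centred_entry C t j (f j) i)\<^sup>2)
        = (\<Sum>j=1..n. real (t j) - (real (t j))\<^sup>2 / real r)"
      using U fj r by (intro sum.cong sum_square_centred_entry) auto
    ultimately have "(\<Sum>i\<in>U. (row_dev C t n f i)\<^sup>2)
        - (\<Sum>j=1..n. real (t j) - (real (t j))\<^sup>2 / real r) = 2 * ?Q f"
      using sum_square_row_dev[OF U(1), of C t n f] by simp
    moreover have "\<bar>?Q f\<bar> \<le> y" using nf by auto
    ultimately show False using f small by (fastforce simp: not_less)
  qed
  have "measure_pmf.prob ?R ?B = measure_pmf.prob ?R (?B \<inter> set_pmf ?R)"
    by (simp add: measure_Int_set_pmf)
  also have "\<dots> \<le> measure_pmf.prob ?R ((\<Union>(s, i)\<in>{1..n} \<times> U. ?W s i) \<union> {f. \<bar>?Q f\<bar> > y})"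
    by (rule measure_pmf.finite_measure_mono[OF sub]) auto
  also have "\<dots> \<le> measure_pmf.prob ?R (\<Union>(s, i)\<in>{1..n} \<times> U. ?W s i)
      + measure_pmf.prob ?R {f. \<bar>?Q f\<bar> > y}"
    by (rule measure_Un_le) auto
  finally show ?thesis using W Q by linarith
qed

text \<open>Constant weights are predictable without clipping. In the mixed sum they are the
  deviations t_i - n \<Lambda> of the column degrees.\<close>

lemma weighted_row_dev_tail:
  fixes U :: "'a set"
  assumes U: "finite U" "\<And>j. C j \<subseteq> U" "U \<noteq> {}"
    and t: "\<And>j. j \<in> {1..n} \<Longrightarrow> t j \<le> card (C j)"
    and n: "n > 0" and w: "\<And>i. i \<in> U \<Longrightarrow> \<bar>w i\<bar> \<le> B" "B > 0"
    and y: "0 \<le> y" "y \<le> 2 * real n * B * real (card U)"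
  shows "measure_pmf.prob (random_columns C t n) {f. \<bar>\<Sum>i\<in>U. row_dev C t n f i * w i\<bar> > y}
    \<le> 2 * exp (- y\<^sup>2 / (4 * real n * (B\<^sup>2 * real (card U))))"
proof -
  have finC: "finite (C j)" for j using U finite_subset by blast
  have "(\<Sum>i\<in>C j. (w i)\<^sup>2) \<le> B\<^sup>2 * real (card U)" for j
  proof -
    have "(\<Sum>i\<in>C j. (w i)\<^sup>2) \<le> (\<Sum>i\<in>C j. B\<^sup>2)"
      using w U(2) by (intro sum_mono) (metis abs_le_square_iff abs_of_pos subset_eq)
    also have "\<dots> \<le> B\<^sup>2 * real (card U)"
      using card_mono[OF U(1) U(2)[of j]] by (simp add: mult.commute mult_right_mono)
    finally show ?thesis .
  qed
  moreover have "card U > 0" using U by (simp add: card_gt_0_iff)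
  moreover have "\<bar>w i\<bar> \<le> B" if "i \<in> C j" for i j using w U(2) that by blast
  ultimately have "measure_pmf.prob (random_columns C t n)
      {f. \<bar>\<Sum>j=1..n. centred_sum C t j (f j) w\<bar> > y}
      \<le> 2 * exp (- y\<^sup>2 / (4 * real n * (B\<^sup>2 * real (card U))))"
    using finC t w y n
    by (intro predictable_tail[where \<beta> = B and d = "\<lambda>j f. w"])
       (auto simp: power2_eq_square mult_right_mono mult_ac intro: order_trans[OF mult_right_mono])
  moreover have "(\<Sum>j=1..n. centred_sum C t j (f j) w) = (\<Sum>i\<in>U. row_dev C t n f i * w i)" for f
    unfolding centred_sum_eq_sum_entries[OF U(2,1)] row_dev_def
    by (subst sum.swap) (simp add: sum_distrib_right)
  ultimately show ?thesis by simp
qed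

subsection \<open>Prescribed column degrees\<close>

definition column :: "(nat \<times> nat) set \<Rightarrow> nat \<Rightarrow> nat set" where
  "column A j = {i. (i, j) \<in> A}"

definition graph_of_columns :: "nat \<Rightarrow> (nat \<Rightarrow> nat set) \<Rightarrow> bigraph" where
  "graph_of_columns n f = {(i, j). j \<in> {1..n} \<and> i \<in> f j}"

lemma deg_v_eq_card_column: "deg_v G j = card (column G j)"
  by (simp add: deg_v_def column_def)

lemma column_graph_of_columns: "j \<in> {1..n} \<Longrightarrow> column (graph_of_columns n f) j = f j"
  by (auto simp: column_def graph_of_columns_def)

text \<open>Prescribing only the column sizes leaves a product set of columns, and the uniform law
  on a product is the product of the uniform laws. The default value, the empty set outside 1..n,
  makes a family of columns recoverable from its graph.\<close>

lemma model_t_eq_map_random_columns: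
  assumes A: "finite A" "A \<subseteq> UNIV \<times> {1..n}"
    and t: "\<And>j. j \<in> {1..n} \<Longrightarrow> t j \<le> card (column A j)"
  shows "model_t A n t = map_pmf (graph_of_columns n) (random_columns (column A) t n)"
proof -
  let ?B = "\<lambda>j. {S. S \<subseteq> column A j \<and> card S = t j}"
  let ?P = "PiE_dflt {1..n} {} ?B"
  have finc: "finite (column A j)" for j
  proof -
    have "column A j \<subseteq> fst ` A" by (force simp: column_def)
    then show ?thesis using A(1) finite_subset by blast
  qed
  have ne: "?B j \<noteq> {}" "finite (?B j)" if "j \<in> {1..n}" for j
    using subsets_card_nonempty[OF finc t[OF that]] by auto
  have inj: "inj_on (graph_of_columns n) ?P"
  proof (rule inj_onI)
    fix f g assume fg: "f \<in> ?P" "g \<in> ?P" "graph_of_columns n f = graph_of_columns n g"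
    show "f = g"
    proof
      fix j
      show "f j = g j"
      proof (cases "j \<in> {1..n}")
        case True
        then show ?thesis using fg(3) column_graph_of_columns by metis
      next
        case False
        then have "f j = {}" "g j = {}" using fg(1,2) by (auto simp: PiE_dflt_def)
        then show ?thesis by simp
      qed
    qed
  qed
  have image: "graph_of_columns n ` ?P = {G. G \<subseteq> A \<and> (\<forall>j\<in>{1..n}. deg_v G j = t j)}" (is "?L = ?R")
  proof
    show "?L \<subseteq> ?R"
      by (auto simp: PiE_dflt_def deg_v_eq_card_column column_graph_of_columns)
         (auto simp: graph_of_columns_def column_def)
    show "?R \<subseteq> ?L"
    proof
      fix G assume G: "G \<in> ?R"
      define f where "f = (\<lambda>j. if j \<in> {1..n} then column G j else {})"
      have "f \<in> ?P"
        using G by (auto simp: f_def PiE_dflt_def deg_v_eq_card_column column_def)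
      moreover have "graph_of_columns n f = G"
        using G A(2) by (auto simp: f_def graph_of_columns_def column_def)
      ultimately show "G \<in> ?L" by blast
    qed
  qed
  have "random_columns (column A) t n = pmf_of_set ?P"
    unfolding random_columns_def using ne by (subst Pi_pmf_of_set) auto
  moreover have "?P \<noteq> {}" "finite ?P"
    using ne by (auto simp: PiE_dflt_empty_iff intro!: finite_PiE_dflt)
  ultimately show ?thesis
    unfolding model_t_def image[symmetric] using inj by (simp add: map_pmf_of_set_inj)
qed

section \<open>Permitted edge sets with and without the diagonal\<close>

text \<open>The two kinds of permitted edge sets; \<open>r\<close> is the number of permitted edges in each column.\<close>

definition host :: "nat \<Rightarrow> nat \<Rightarrow> (nat \<times> nat) set \<Rightarrow> nat \<Rightarrow> bool" where
  "host m n A r \<longleftrightarrow> A = all_edges m n \<and> r = m \<or> m = n \<and> A = offdiag_edges n \<and> r = n - 1"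

lemma column_host:
  assumes "host m n A r" "j \<in> {1..n}"
  shows "column A j = {1..m} \<and> r = m \<or> m = n \<and> column A j = {1..n} - {j} \<and> r = n - 1"
  using assms(1) unfolding host_def
proof (elim disjE conjE)
  assume "A = all_edges m n" "r = m"
  then show ?thesis using assms(2) by (auto simp: column_def all_edges_def)
next
  assume h: "m = n" "A = offdiag_edges n" "r = n - 1"
  then have "column A j = {1..n} - {j}" using assms(2) by (auto simp: column_def offdiag_edges_def)
  then show ?thesis using h by blast
qed

lemma card_column_host:
  assumes "host m n A r" "j \<in> {1..n}"
  shows "card (column A j) = r"
proof -
  have "card ({1..n} - {j}) = n - 1" using assms(2) by simp
  then show ?thesis using column_host[OF assms] by (elim disjE) simp_all
qed

lemma host_subset: "host m n A r \<Longrightarrow> A \<subseteq> {1..m} \<times> {1..n}"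
  unfolding host_def
proof (elim disjE conjE)
  show "A = all_edges m n \<Longrightarrow> A \<subseteq> {1..m} \<times> {1..n}" by (simp add: all_edges_def)
  show "m = n \<Longrightarrow> A = offdiag_edges n \<Longrightarrow> A \<subseteq> {1..m} \<times> {1..n}"
    by (auto simp: offdiag_edges_def)
qed

lemma column_host_subset: "host m n A r \<Longrightarrow> column A j \<subseteq> {1..m}"
  using host_subset by (fastforce simp: column_def)

lemma finite_host: "host m n A r \<Longrightarrow> finite A"
  by (rule finite_subset[OF host_subset]) simp_all

lemma host_bounds:
  assumes "host m n A r" "m \<ge> 2"
  shows "r > 0" "r \<le> m" "real m - real r \<le> 1" "real m \<le> 2 * real r"
  using assms by (auto simp: host_def)

lemma card_eq_sum_column:
  assumes "finite G" "G \<subseteq> UNIV \<times> {1..n}"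
  shows "card G = (\<Sum>j=1..n. card (column G j))"
proof -
  have fin: "finite (column G j)" for j
  proof -
    have "column G j \<subseteq> fst ` G" by (force simp: column_def)
    then show ?thesis using assms(1) finite_subset by blast
  qed
  have "card G = card (SIGMA j:{1..n}. column G j)"
    using assms by (intro bij_betw_same_card[of prod.swap] bij_betwI[where g = prod.swap])
      (auto simp: column_def)
  also have "\<dots> = (\<Sum>j=1..n. card (column G j))"
    using fin by (simp add: card_SigmaI)
  finally show ?thesis .
qed

lemma card_host: "host m n A r \<Longrightarrow> card A = n * r"
proof -
  assume A: "host m n A r"
  have "A \<subseteq> UNIV \<times> {1..n}" using host_subset[OF A] by blast
  then show ?thesis
    using card_eq_sum_column[OF finite_host[OF A]] card_column_host[OF A] by simp
qed

text \<open>Once the column degrees are fixed, the random density is a constant and the centres in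
  \<open>U_dev\<close> and \<open>UV_dev\<close> no longer move with the graph.\<close>

lemma edge_density_eq_lambda_vec:
  assumes "finite G" "G \<subseteq> UNIV \<times> {1..n}" "\<And>j. j \<in> {1..n} \<Longrightarrow> deg_v G j = t j"
  shows "edge_density m n G = lambda_vec m n t"
proof -
  have "card G = (\<Sum>j=1..n. t j)"
    unfolding card_eq_sum_column[OF assms(1,2)]
    using assms(3) by (intro sum.cong) (auto simp: deg_v_eq_card_column)
  then show ?thesis by (simp add: edge_density_def lambda_vec_def)
qed

section \<open>Row means and explicit tail bounds for fixed column degrees\<close>

text \<open>The expected degree of \<open>u\<^sub>i\<close> in \<open>\<G>\<^sub>t\<close> minus \<open>n\<Lambda>\<close>; nonzero only if the diagonal is excluded.\<close>

definition mean_shift :: "nat \<Rightarrow> nat \<Rightarrow> (nat \<times> nat) set \<Rightarrow> nat \<Rightarrow> (nat \<Rightarrow> nat) \<Rightarrow> nat \<Rightarrow> real" where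
  "mean_shift m n A r t i
     = (\<Sum>j=1..n. if i \<in> column A j then real (t j) / real r else 0) - real n * lambda_vec m n t"

lemma deg_u_eq_row_dev:
  assumes A: "host m n A r"
    and f: "\<And>j. j \<in> {1..n} \<Longrightarrow> f j \<subseteq> column A j"
  shows "real (deg_u (graph_of_columns n f) i) - real n * lambda_vec m n t
    = row_dev (column A) t n f i + mean_shift m n A r t i"
proof -
  have "{j. (i, j) \<in> graph_of_columns n f} = {j\<in>{1..n}. i \<in> f j}"
    by (auto simp: graph_of_columns_def)
  then have "real (deg_u (graph_of_columns n f) i) = (\<Sum>j=1..n. of_bool (i \<in> f j))"
    unfolding deg_u_def by (simp add: Int_def of_bool_def sum.If_cases)
  also have "\<dots> = (\<Sum>j=1..n. centred_entry (column A) t j (f j) i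
      + (if i \<in> column A j then real (t j) / real r else 0))"
  proof (rule sum.cong)
    fix j assume "j \<in> {1..n}"
    then show "of_bool (i \<in> f j) = centred_entry (column A) t j (f j) i
        + (if i \<in> column A j then real (t j) / real r else 0)"
      using f[of j] card_column_host[OF A, of j] by (auto simp: centred_entry_def)
  qed simp
  finally show ?thesis by (simp add: row_dev_def mean_shift_def sum.distrib)
qed

text \<open>With full columns every row has mean exactly n \<Lambda>. Without the diagonal, row i
  misses column i, and with T the sum of the t_j the shift (T - t_i)/(n - 1) - T/n equals (T/n -
  t_i)/(n - 1): a deviation of size B divided by n - 1.\<close>

lemma mean_shift_le:
  assumes A: "host m n A r" "m \<ge> 2" and n: "n > 0"
    and t: "\<And>j. j \<in> {1..n} \<Longrightarrow> \<bar>real (t j) - real m * lambda_vec m n t\<bar> \<le> B"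
    and i: "i \<in> {1..m}" and B: "B \<ge> 0"
  shows "\<bar>mean_shift m n A r t i\<bar> \<le> 2 * B / real m"
proof (cases "A = all_edges m n \<and> r = m")
  case True
  then have "mean_shift m n A r t i = 0"
  proof -
    have "(\<Sum>j=1..n. if i \<in> column A j then real (t j) / real r else 0) = (\<Sum>j=1..n. real (t j) / real m)"
      using True i by (intro sum.cong) (auto simp: column_def all_edges_def)
    then show ?thesis
      using n by (simp add: mean_shift_def lambda_vec_def flip: sum_divide_distrib)
  qed
  then show ?thesis using B by simp
next
  case False
  then have h: "m = n" "A = offdiag_edges n" "r = n - 1" using A by (auto simp: host_def)
  have n2: "real n \<ge> 2" using A h by simp
  define T where "T = (\<Sum>j=1..n. real (t j))"
  have "(\<Sum>j=1..n. if i \<in> column A j then real (t j) / real r else 0)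
      = (\<Sum>j\<in>{1..n} - {i}. real (t j) / real r)"
    using i h by (intro sum.mono_neutral_cong_right) (auto simp: column_def offdiag_edges_def)
  also have "\<dots> = (T - real (t i)) / real r"
    using i h by (simp add: T_def sum_diff1 flip: sum_divide_distrib)
  finally have S: "(\<Sum>j=1..n. if i \<in> column A j then real (t j) / real r else 0)
      = (T - real (t i)) / real r" .
  have "mean_shift m n A r t i = (T - real (t i)) / (real n - 1) - T / real n"
  proof -
    have "real r = real n - 1" using n2 h by (simp add: of_nat_diff)
    moreover have "real n * lambda_vec m n t = T / real n"
      using n2 h by (simp add: lambda_vec_def T_def)
    ultimately show ?thesis using S unfolding mean_shift_def by simp
  qed
  also have "\<dots> = (T / real n - real (t i)) / (real n - 1)"
  proof -
    have "(T - x) / N - T / (N + 1) = (T / (N + 1) - x) / N" if "N > 0" for x N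
      using that by (simp add: divide_simps) (simp add: algebra_simps)
    from this[of "real n - 1"] show ?thesis using n2 by simp
  qed
  also have "\<bar>\<dots>\<bar> \<le> B / (real n - 1)"
  proof -
    have "\<bar>T / real n - real (t i)\<bar> \<le> B"
      using t[of i] i h n2 by (simp add: lambda_vec_def T_def abs_minus_commute)
    then show ?thesis using n2 by (simp add: abs_divide divide_right_mono)
  qed
  also have "\<dots> \<le> 2 * B / real n"
  proof -
    have "B * real n \<le> B * (2 * (real n - 1))" using B n2 by (intro mult_left_mono) auto
    then show ?thesis using n2 by (simp add: divide_simps mult_ac)
  qed
  finally show ?thesis using h by simp
qed

text \<open>The difference is exactly minus two nonnegative terms. One comes from r falling short of
  m and is at most 2n; the other is V / r, with V the sum of the squared deviations of the column
  degrees.\<close>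

lemma column_variance_sum:
  assumes A: "host m n A r" "m \<ge> 2" and n: "n > 0"
    and t: "\<And>j. j \<in> {1..n} \<Longrightarrow> \<bar>real (t j) - real m * lambda_vec m n t\<bar> \<le> B"
      "\<And>j. j \<in> {1..n} \<Longrightarrow> t j \<le> r"
    and B: "B \<ge> 0"
  defines "l \<equiv> lambda_vec m n t"
  shows "\<bar>(\<Sum>j=1..n. real (t j) - (real (t j))\<^sup>2 / real r) - l * (1 - l) * real m * real n\<bar>
    \<le> 2 * real n + 2 * real n * B\<^sup>2 / real m"
proof -
  note r = host_bounds[OF A]
  have m: "real m \<ge> 2" using A by simp
  have T: "(\<Sum>j=1..n. real (t j)) = real m * real n * l"
    using m n by (simp add: l_def lambda_vec_def)
  have l: "0 \<le> l" "l \<le> 1"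
  proof -
    show "0 \<le> l" unfolding l_def lambda_vec_def by (intro divide_nonneg_nonneg sum_nonneg) auto
    have "(\<Sum>j=1..n. real (t j)) \<le> (\<Sum>j=1..n. real m)"
      using t(2) r by (intro sum_mono) fastforce
    then show "l \<le> 1" using m n by (simp add: l_def lambda_vec_def divide_le_eq mult.commute)
  qed
  define V where "V = (\<Sum>j=1..n. (real (t j) - real m * l)\<^sup>2)"
  have V: "0 \<le> V" "V \<le> real n * B\<^sup>2"
  proof -
    show "0 \<le> V" unfolding V_def by (intro sum_nonneg) auto
    have "V \<le> (\<Sum>j=1..n. B\<^sup>2)"
      unfolding V_def
    proof (intro sum_mono)
      fix j assume "j \<in> {1..n}"
      then show "(real (t j) - real m * l)\<^sup>2 \<le> B\<^sup>2"
        using t(1)[of j] B by (simp add: l_def flip: abs_le_square_iff)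
    qed
    then show "V \<le> real n * B\<^sup>2" by simp
  qed
  have V_eq: "V = (\<Sum>j=1..n. (real (t j))\<^sup>2) - real n * (real m * l)\<^sup>2"
  proof -
    have "V = (\<Sum>j=1..n. (real (t j))\<^sup>2 - 2 * (real m * l) * real (t j) + (real m * l)\<^sup>2)"
      unfolding V_def by (intro sum.cong) (auto simp: power2_diff algebra_simps)
    also have "\<dots> = (\<Sum>j=1..n. (real (t j))\<^sup>2) - 2 * (real m * l) * (\<Sum>j=1..n. real (t j))
        + real n * (real m * l)\<^sup>2"
      by (simp add: sum.distrib sum_subtractf sum_distrib_left)
    finally show ?thesis unfolding T by (simp add: power2_eq_square algebra_simps)
  qed
  have "(\<Sum>j=1..n. real (t j) - (real (t j))\<^sup>2 / real r) - l * (1 - l) * real m * real n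
      = - (real n * l\<^sup>2 * (real m * ((real m - real r) / real r)) + V / real r)"
    unfolding sum_subtractf T sum_divide_distrib[symmetric] V_eq using r
    by (simp add: field_simps power2_eq_square)
  moreover have "0 \<le> real n * l\<^sup>2 * (real m * ((real m - real r) / real r)) + V / real r"
    using V r by (intro add_nonneg_nonneg mult_nonneg_nonneg divide_nonneg_nonneg) auto
  moreover have "real n * l\<^sup>2 * (real m * ((real m - real r) / real r)) \<le> real n * 1 * 2"
  proof (intro mult_mono)
    show "l\<^sup>2 \<le> 1" using l by (simp add: power_le_one)
    have "real m * (real m - real r) \<le> real m * 1"
      using r by (intro mult_left_mono) auto
    also have "\<dots> \<le> 2 * real r" using r by simp
    finally show "real m * ((real m - real r) / real r) \<le> 2"
      using r(1) by (simp add: divide_le_eq)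
  qed (use r in auto)
  moreover have "V / real r \<le> 2 * real n * B\<^sup>2 / real m"
  proof -
    have "V / real r \<le> (real n * B\<^sup>2) / (real m / 2)"
      using V r m by (intro frac_le) auto
    then show ?thesis by (simp add: mult_ac)
  qed
  ultimately show ?thesis by linarith
qed

text \<open>Each S_i - n \<Lambda> is a row deviation plus a mean shift. On expanding the square, 2y
  comes from the martingale, 4bB from the m mixed terms of size at most 2 * b * 2B/m, 4B^2/m from
  the squared shifts, and the last two terms from \<open>column_variance_sum\<close>.\<close>

lemma model_t_U_tail:
  assumes A: "host m n A r" "m \<ge> 2" and n: "n > 0"
    and t: "\<And>j. j \<in> {1..n} \<Longrightarrow> \<bar>real (t j) - real m * lambda_vec m n t\<bar> \<le> B"
      "\<And>j. j \<in> {1..n} \<Longrightarrow> t j \<le> r"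
    and B: "B \<ge> 0" and b: "0 < b" "b \<le> 2 * real n"
    and y: "0 \<le> y" "y \<le> 2 * real n * b * real m"
  shows "measure_pmf.prob (model_t A n t) {G. \<bar>U_dev m n G - var_scale m n G\<bar>
        > 2 * y + 4 * b * B + 4 * B\<^sup>2 / real m + 2 * real n + 2 * real n * B\<^sup>2 / real m}
    \<le> 2 * real m * real n * exp (- b\<^sup>2 / (4 * real n))
      + 2 * exp (- y\<^sup>2 / (4 * real n * (b\<^sup>2 * real m)))" (is "measure_pmf.prob _ ?E \<le> _")
proof -
  let ?R = "random_columns (column A) t n"
  let ?l = "lambda_vec m n t"
  note r = host_bounds[OF A]
  have m: "real m \<ge> 2" using A by simp
  have tc: "t j \<le> card (column A j)" if "j \<in> {1..n}" for j
    using t(2)[OF that] card_column_host[OF A(1) that] by simp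
  have finc: "finite (column A j)" for j
    using column_host_subset[OF A(1)] finite_subset by blast
  have Asub: "A \<subseteq> UNIV \<times> {1..n}" using host_subset[OF A(1)] by blast
  let ?B = "{f. (\<exists>i\<in>{1..m}. \<bar>row_dev (column A) t n f i\<bar> > b) \<or>
      \<bar>(\<Sum>i=1..m. (row_dev (column A) t n f i)\<^sup>2)
        - (\<Sum>j=1..n. real (t j) - (real (t j))\<^sup>2 / real r)\<bar> > 2 * y}"
  have "measure_pmf.prob (model_t A n t) ?E = measure_pmf.prob ?R (graph_of_columns n -` ?E)"
    by (subst model_t_eq_map_random_columns[OF finite_host[OF A(1)] Asub tc]) auto
  also have "\<dots> = measure_pmf.prob ?R (graph_of_columns n -` ?E \<inter> set_pmf ?R)"
    by (simp add: measure_Int_set_pmf)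
  also have "\<dots> \<le> measure_pmf.prob ?R ?B"
  proof (intro measure_pmf.finite_measure_mono subsetI)
    fix f assume f: "f \<in> graph_of_columns n -` ?E \<inter> set_pmf ?R"
    show "f \<in> ?B"
    proof (rule ccontr)
      assume "f \<notin> ?B"
      then have W: "\<And>i. i \<in> {1..m} \<Longrightarrow> \<bar>row_dev (column A) t n f i\<bar> \<le> b"
        and Q: "\<bar>(\<Sum>i=1..m. (row_dev (column A) t n f i)\<^sup>2)
          - (\<Sum>j=1..n. real (t j) - (real (t j))\<^sup>2 / real r)\<bar> \<le> 2 * y"
        by (auto simp: not_less)
      have fj: "f j \<subseteq> column A j" "card (f j) = t j" if "j \<in> {1..n}" for j
        using f finc tc random_columnsD[OF _ that, of f "column A" t] by auto
      define G where "G = graph_of_columns n f"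
      have G: "G \<subseteq> A" using fj(1) by (auto simp: G_def graph_of_columns_def column_def)
      have dens: "edge_density m n G = ?l"
        using G Asub finite_host[OF A(1)] fj finite_subset
        by (intro edge_density_eq_lambda_vec)
           (auto simp: G_def deg_v_eq_card_column column_graph_of_columns)
      let ?w = "row_dev (column A) t n f" and ?s = "mean_shift m n A r t"
      have s: "\<bar>?s i\<bar> \<le> 2 * B / real m" if "i \<in> {1..m}" for i
        using mean_shift_le[OF A n t(1) that B] by simp
      have "U_dev m n G = (\<Sum>i=1..m. (?w i + ?s i)\<^sup>2)"
        unfolding U_dev_def dens unfolding G_def by (simp only: deg_u_eq_row_dev[OF A(1) fj(1)])
      also have "\<dots> = (\<Sum>i=1..m. (?w i)\<^sup>2) + 2 * (\<Sum>i=1..m. ?w i * ?s i) + (\<Sum>i=1..m. (?s i)\<^sup>2)"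
        by (simp add: power2_sum sum.distrib sum_distrib_left mult_ac)
      finally have U: "U_dev m n G
        = (\<Sum>i=1..m. (?w i)\<^sup>2) + 2 * (\<Sum>i=1..m. ?w i * ?s i) + (\<Sum>i=1..m. (?s i)\<^sup>2)" .
      have "\<bar>\<Sum>i=1..m. ?w i * ?s i\<bar> \<le> (\<Sum>i=1..m. b * (2 * B / real m))"
      proof (intro order_trans[OF sum_abs] sum_mono)
        fix i assume i: "i \<in> {1..m}"
        show "\<bar>?w i * ?s i\<bar> \<le> b * (2 * B / real m)"
          unfolding abs_mult using W[OF i] s[OF i] b by (intro mult_mono) auto
      qed
      then have ws: "\<bar>\<Sum>i=1..m. ?w i * ?s i\<bar> \<le> 2 * b * B" using m by simp
      have "(\<Sum>i=1..m. (?s i)\<^sup>2) \<le> (\<Sum>i=1..m. (2 * B / real m)\<^sup>2)"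
        using s B m by (intro sum_mono) (simp flip: abs_le_square_iff)
      then have ss: "(\<Sum>i=1..m. (?s i)\<^sup>2) \<le> 4 * B\<^sup>2 / real m"
        using m by (simp add: power2_eq_square field_simps)
      have ss0: "0 \<le> (\<Sum>i=1..m. (?s i)\<^sup>2)" by (intro sum_nonneg) auto
      have "\<bar>U_dev m n G - ?l * (1 - ?l) * real m * real n\<bar>
          \<le> 2 * y + 4 * b * B + 4 * B\<^sup>2 / real m + 2 * real n + 2 * real n * B\<^sup>2 / real m"
        using U ws ss ss0 Q column_variance_sum[OF A n t B] by linarith
      moreover have "G \<in> ?E" using f by (simp add: G_def)
      ultimately show False by (simp add: var_scale_def dens)
    qed
  qed auto
  also have "\<dots> \<le> 2 * real (card {1..m}) * real n * exp (- b\<^sup>2 / (4 * real n))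
      + 2 * exp (- y\<^sup>2 / (4 * real n * (b\<^sup>2 * real (card {1..m}))))"
    using tc b y n r m card_column_host[OF A(1)] column_host_subset[OF A(1)]
    by (intro sum_square_row_dev_tail) auto
  finally show ?thesis by simp
qed

text \<open>The factors T_i - n \<Lambda> are constants of size at most B, so the random part is
  linear in the row deviations. The mean shifts add at most n * (2B/n) * B = 2B^2.\<close>

lemma model_t_UV_tail:
  assumes A: "host n n A r" "n \<ge> 2"
    and t: "\<And>j. j \<in> {1..n} \<Longrightarrow> \<bar>real (t j) - real n * lambda_vec n n t\<bar> \<le> B"
      "\<And>j. j \<in> {1..n} \<Longrightarrow> t j \<le> r"
    and B: "B > 0" and y: "0 \<le> y" "y \<le> 2 * real n * B * real n"
  shows "measure_pmf.prob (model_t A n t) {G. \<bar>UV_dev n G\<bar> > y + 2 * B\<^sup>2}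
    \<le> 2 * exp (- y\<^sup>2 / (4 * real n * (B\<^sup>2 * real n)))" (is "measure_pmf.prob _ ?E \<le> _")
proof -
  let ?R = "random_columns (column A) t n"
  let ?l = "lambda_vec n n t"
  let ?d = "\<lambda>i. real (t i) - real n * ?l"
  have n: "real n \<ge> 2" using A by simp
  have tc: "t j \<le> card (column A j)" if "j \<in> {1..n}" for j
    using t(2)[OF that] card_column_host[OF A(1) that] by simp
  have finc: "finite (column A j)" for j
    using column_host_subset[OF A(1)] finite_subset by blast
  have Asub: "A \<subseteq> UNIV \<times> {1..n}" using host_subset[OF A(1)] by blast
  let ?B = "{f. \<bar>\<Sum>i=1..n. row_dev (column A) t n f i * ?d i\<bar> > y}"
  have "measure_pmf.prob (model_t A n t) ?E = measure_pmf.prob ?R (graph_of_columns n -` ?E)"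
    by (subst model_t_eq_map_random_columns[OF finite_host[OF A(1)] Asub tc]) auto
  also have "\<dots> = measure_pmf.prob ?R (graph_of_columns n -` ?E \<inter> set_pmf ?R)"
    by (simp add: measure_Int_set_pmf)
  also have "\<dots> \<le> measure_pmf.prob ?R ?B"
  proof (intro measure_pmf.finite_measure_mono subsetI)
    fix f assume f: "f \<in> graph_of_columns n -` ?E \<inter> set_pmf ?R"
    have fj: "f j \<subseteq> column A j" "card (f j) = t j" if "j \<in> {1..n}" for j
      using f finc tc random_columnsD[OF _ that, of f "column A" t] by auto
    define G where "G = graph_of_columns n f"
    have G: "G \<subseteq> A" using fj(1) by (auto simp: G_def graph_of_columns_def column_def)
    have degv: "deg_v G j = t j" if "j \<in> {1..n}" for j
      using that fj by (simp add: G_def deg_v_eq_card_column column_graph_of_columns)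
    have dens: "edge_density n n G = ?l"
      using G Asub finite_host[OF A(1)] finite_subset degv
      by (intro edge_density_eq_lambda_vec) auto
    let ?w = "row_dev (column A) t n f" and ?s = "mean_shift n n A r t"
    have "UV_dev n G = (\<Sum>i=1..n. (?w i + ?s i) * ?d i)"
      unfolding UV_dev_def dens
    proof (intro sum.cong refl)
      fix i assume "i \<in> {1..n}"
      then show "(real (deg_u G i) - real n * ?l) * (real (deg_v G i) - real n * ?l)
          = (?w i + ?s i) * ?d i"
        unfolding degv[OF \<open>i \<in> {1..n}\<close>] unfolding G_def
        by (simp only: deg_u_eq_row_dev[OF A(1) fj(1)])
    qed
    then have UV: "UV_dev n G = (\<Sum>i=1..n. ?w i * ?d i) + (\<Sum>i=1..n. ?s i * ?d i)"
      by (simp add: distrib_right sum.distrib)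
    have "\<bar>\<Sum>i=1..n. ?s i * ?d i\<bar> \<le> (\<Sum>i=1..n. (2 * B / real n) * B)"
    proof (intro order_trans[OF sum_abs] sum_mono)
      fix i assume i: "i \<in> {1..n}"
      have "\<bar>?s i\<bar> \<le> 2 * B / real n" using n B by (intro mean_shift_le[OF A _ t(1) i]) auto
      then show "\<bar>?s i * ?d i\<bar> \<le> (2 * B / real n) * B"
        unfolding abs_mult using t(1)[OF i] B n by (intro mult_mono) auto
    qed
    then have "\<bar>\<Sum>i=1..n. ?s i * ?d i\<bar> \<le> 2 * B\<^sup>2" using n by (simp add: power2_eq_square)
    moreover have "\<bar>UV_dev n G\<bar> > y + 2 * B\<^sup>2" using f by (simp add: G_def)
    ultimately show "f \<in> ?B" using UV by auto
  qed auto
  also have "\<dots> \<le> 2 * exp (- y\<^sup>2 / (4 * real n * (B\<^sup>2 * real (card {1..n}))))"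
    using tc y n B t(1) column_host_subset[OF A(1)]
    by (intro weighted_row_dev_tail) auto
  finally show ?thesis by simp
qed

lemma model_t_edge_density:
  assumes A: "host m n A r" and t: "\<And>j. j \<in> {1..n} \<Longrightarrow> t j \<le> r"
    and G: "G \<in> set_pmf (model_t A n t)"
  shows "edge_density m n G = lambda_vec m n t"
proof -
  have Asub: "A \<subseteq> UNIV \<times> {1..n}" using host_subset[OF A] by blast
  have tc: "t j \<le> card (column A j)" if "j \<in> {1..n}" for j
    using t[OF that] card_column_host[OF A that] by simp
  have finc: "finite (column A j)" for j
    using column_host_subset[OF A] finite_subset by blast
  obtain f where f: "f \<in> set_pmf (random_columns (column A) t n)" "G = graph_of_columns n f"
    using G model_t_eq_map_random_columns[OF finite_host[OF A] Asub tc] by auto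
  have fj: "f j \<subseteq> column A j" "card (f j) = t j" if "j \<in> {1..n}" for j
    using finc tc random_columnsD[OF f(1) that] by auto
  have "G \<subseteq> A" using fj(1) by (auto simp: f graph_of_columns_def column_def)
  then show ?thesis
    using Asub finite_host[OF A] fj finite_subset
    by (intro edge_density_eq_lambda_vec)
       (auto simp: f deg_v_eq_card_column column_graph_of_columns)
qed

section \<open>Deviation scales and the comparison of error terms\<close>

text \<open>The reason is (1 + \<epsilon>)(1 - \<epsilon>) \<le> 1. With x = n and \<mu> = m it
  bounds m below by a power of n, so that the errors can be compared through powers of n.\<close>

lemma powr_comparable:
  fixes x \<mu> \<epsilon> :: real
  assumes "x \<ge> 1" "\<mu> \<ge> 1" "0 < \<epsilon>" "\<epsilon> \<le> 1" "x \<le> \<mu> powr (1 + \<epsilon>)"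
  shows "x powr (1 - \<epsilon>) \<le> \<mu>"
proof -
  have "x powr (1 - \<epsilon>) \<le> (\<mu> powr (1 + \<epsilon>)) powr (1 - \<epsilon>)"
    using assms by (intro powr_mono2) auto
  also have "\<dots> = \<mu> powr (1 - \<epsilon> * \<epsilon>)" by (simp add: powr_powr algebra_simps)
  also have "\<dots> \<le> \<mu> powr 1" using assms by (intro powr_mono) auto
  finally show ?thesis using assms by simp
qed

text \<open>Here x = n, \<mu> = m and L is a lower-bounded density factor \<Lambda>(1 - \<Lambda>).
  All error terms together are at most the constant of hypothesis K times M = x^(1/2 +
  3\<epsilon>/2) \<mu>. The target is x^(\<epsilon>/2) L M, and K with L \<ge> c / ln x says that
  x^(\<epsilon>/2) L outweighs that constant. The second claim serves the mixed sum.\<close>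

lemma U_error_le:
  fixes x \<mu> \<epsilon> c C L :: real
  assumes \<epsilon>: "0 < \<epsilon>" "\<epsilon> \<le> 1/8" and c: "c > 0" "C > 0" and x: "x \<ge> 3" and \<mu>: "x powr (1 - \<epsilon>) \<le> \<mu>"
    and K: "(6 + 4 * C + 6 * C\<^sup>2) * ln x \<le> c * x powr (\<epsilon>/2)" and L: "c / ln x \<le> L"
  defines "B \<equiv> C * x powr (1/2 + \<epsilon>)"
  shows "2 * (2 * x powr (1 + \<epsilon>/2) * sqrt \<mu>) + 4 * x powr (1/2 + \<epsilon>/4) * B + 4 * B\<^sup>2 / \<mu> + 2 * x + 2 * x * B\<^sup>2 / \<mu>
    \<le> x powr (-1/2 + 2 * \<epsilon>) * (L * \<mu> * x)"
    and "\<mu> = x \<Longrightarrow> 2 * x powr (1 + \<epsilon>/4) * B + 2 * B\<^sup>2 \<le> x powr (-1/2 + 2 * \<epsilon>) * (L * \<mu> * x)"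
proof -
  have lnx: "ln x > 0" using x by simp
  have "x powr (1 - \<epsilon>) > 0" using x by simp
  then have \<mu>0: "\<mu> > 0" using \<mu> by linarith
  define M where "M = x powr (1/2 + 3 * \<epsilon>/2) * \<mu>"
  have "(6 + 4 * C + 6 * C\<^sup>2) * M \<le> (c * x powr (\<epsilon>/2) / ln x) * M"
    using K lnx \<mu>0 by (intro mult_right_mono) (auto simp: M_def field_simps)
  also have "\<dots> = (c / ln x) * (x powr (\<epsilon>/2) * x powr (1/2 + 3 * \<epsilon>/2) * \<mu>)"
    by (simp add: M_def)
  also have "x powr (\<epsilon>/2) * x powr (1/2 + 3 * \<epsilon>/2) = x powr (-1/2 + 2 * \<epsilon>) * x powr 1"
    unfolding powr_add[symmetric] by (simp add: add.commute)
  also have "(c / ln x) * (x powr (-1/2 + 2 * \<epsilon>) * x powr 1 * \<mu>)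
      \<le> L * (x powr (-1/2 + 2 * \<epsilon>) * x powr 1 * \<mu>)"
    using L \<mu>0 by (intro mult_right_mono) auto
  also have "\<dots> = x powr (-1/2 + 2 * \<epsilon>) * (L * \<mu> * x)" using x by (simp add: mult_ac)
  finally have main: "(6 + 4 * C + 6 * C\<^sup>2) * M \<le> x powr (-1/2 + 2 * \<epsilon>) * (L * \<mu> * x)" .
  have M_ge: "x powr e \<le> M" if "e \<le> 3/2 + \<epsilon>/2" for e
  proof -
    have "x powr e \<le> x powr ((1/2 + 3 * \<epsilon>/2) + (1 - \<epsilon>))" using that x by (intro powr_mono) auto
    also have "\<dots> = x powr (1/2 + 3 * \<epsilon>/2) * x powr (1 - \<epsilon>)" by (rule powr_add)
    also have "\<dots> \<le> M" unfolding M_def using \<mu> by (intro mult_left_mono) auto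
    finally show ?thesis .
  qed
  have B2: "B\<^sup>2 = C\<^sup>2 * x powr (1 + 2 * \<epsilon>)"
    unfolding B_def by (simp add: power2_eq_square algebra_simps flip: powr_add)
  have T1: "x powr (1 + \<epsilon>/2) * sqrt \<mu> \<le> M"
  proof -
    have "sqrt (x powr (1 - \<epsilon>)) \<le> sqrt \<mu>" using \<mu> by simp
    then have s: "x powr (1/2 - \<epsilon>/2) \<le> sqrt \<mu>"
      by (simp add: powr_half_sqrt[symmetric] powr_powr diff_divide_distrib)
    \<comment> \<open>The factor x^(1/2 - \<epsilon>/2) is traded for a second sqrt \<mu>.\<close>
    have "x powr (1 + \<epsilon>/2) * sqrt \<mu> = x powr (1/2 + \<epsilon>) * x powr (1/2 - \<epsilon>/2) * sqrt \<mu>"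
      by (simp flip: powr_add)
    also have "\<dots> \<le> x powr (1/2 + 3 * \<epsilon>/2) * sqrt \<mu> * sqrt \<mu>"
      using s \<mu>0 x \<epsilon> by (intro mult_mono powr_mono) auto
    also have "\<dots> = M" using \<mu>0 by (simp add: M_def)
    finally show ?thesis .
  qed
  have T2: "x powr (1/2 + \<epsilon>/4) * B \<le> C * M"
  proof -
    have "x powr (1/2 + \<epsilon>/4) * B = C * x powr (1 + 5 * \<epsilon>/4)"
      by (simp add: B_def flip: powr_add)
    also have "\<dots> \<le> C * M" using c \<epsilon> by (intro mult_left_mono M_ge) auto
    finally show ?thesis .
  qed
  have T3: "x * B\<^sup>2 / \<mu> \<le> C\<^sup>2 * M"
  proof -
    \<comment> \<open>This comparison, 2 + 2\<epsilon> \<le> 5/2 - \<epsilon>/2, amounts to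
      \<epsilon> \<le> 1/5, the tightest demand on \<epsilon>.\<close>
    have "x powr (2 + 2 * \<epsilon>) \<le> x powr (1/2 + 3 * \<epsilon>/2 + (1 - \<epsilon>) + (1 - \<epsilon>))"
      using x \<epsilon> by (intro powr_mono) auto
    also have "\<dots> = x powr (1/2 + 3 * \<epsilon>/2) * x powr (1 - \<epsilon>) * x powr (1 - \<epsilon>)"
      by (simp only: powr_add)
    also have "\<dots> \<le> x powr (1/2 + 3 * \<epsilon>/2) * \<mu> * \<mu>"
      using \<mu> \<mu>0 by (intro mult_mono) auto
    finally have "x powr (2 + 2 * \<epsilon>) / \<mu> \<le> M" using \<mu>0 by (simp add: M_def divide_le_eq)
    then have "C\<^sup>2 * (x powr (2 + 2 * \<epsilon>) / \<mu>) \<le> C\<^sup>2 * M" by (intro mult_left_mono) auto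
    moreover have "x powr (2 + 2 * \<epsilon>) = x * x powr (1 + 2 * \<epsilon>)"
      using powr_add[of x 1 "1 + 2 * \<epsilon>"] x by (simp add: algebra_simps)
    ultimately show ?thesis by (simp add: B2 mult_ac)
  qed
  have T3': "B\<^sup>2 / \<mu> \<le> x * B\<^sup>2 / \<mu>"
  proof -
    have "1 * B\<^sup>2 \<le> x * B\<^sup>2" using x by (intro mult_right_mono) auto
    then show ?thesis using \<mu>0 by (intro divide_right_mono) auto
  qed
  have T4: "x \<le> M" using M_ge[of 1] x \<epsilon> by simp
  have "2 * (2 * x powr (1 + \<epsilon>/2) * sqrt \<mu>) + 4 * x powr (1/2 + \<epsilon>/4) * B + 4 * B\<^sup>2 / \<mu> + 2 * x + 2 * x * B\<^sup>2 / \<mu>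
      = 4 * (x powr (1 + \<epsilon>/2) * sqrt \<mu>) + 4 * (x powr (1/2 + \<epsilon>/4) * B) + 4 * (B\<^sup>2 / \<mu>) + 2 * x + 2 * (x * B\<^sup>2 / \<mu>)"
    by simp
  also have "\<dots> \<le> 4 * M + 4 * (C * M) + 4 * (C\<^sup>2 * M) + 2 * M + 2 * (C\<^sup>2 * M)"
    using T1 T2 T3 T4 order_trans[OF T3' T3] by (intro add_mono mult_left_mono) auto
  also have "\<dots> = (6 + 4 * C + 6 * C\<^sup>2) * M" by (simp add: algebra_simps)
  finally show "2 * (2 * x powr (1 + \<epsilon>/2) * sqrt \<mu>) + 4 * x powr (1/2 + \<epsilon>/4) * B + 4 * B\<^sup>2 / \<mu> + 2 * x + 2 * x * B\<^sup>2 / \<mu>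
    \<le> x powr (-1/2 + 2 * \<epsilon>) * (L * \<mu> * x)"
    using main by linarith
  show "2 * x powr (1 + \<epsilon>/4) * B + 2 * B\<^sup>2 \<le> x powr (-1/2 + 2 * \<epsilon>) * (L * \<mu> * x)" if "\<mu> = x"
  proof -
    have M: "M = x powr (3/2 + 3 * \<epsilon>/2)"
      using powr_add[of x "1/2 + 3 * \<epsilon>/2" 1] x by (simp add: M_def that algebra_simps)
    have "x powr (1 + \<epsilon>/4) * B = C * x powr (3/2 + 5 * \<epsilon>/4)"
      by (simp add: B_def flip: powr_add)
    also have "\<dots> \<le> C * M" unfolding M using c \<epsilon> x by (intro mult_left_mono powr_mono) auto
    finally have 1: "x powr (1 + \<epsilon>/4) * B \<le> C * M" .
    have 2: "B\<^sup>2 \<le> C\<^sup>2 * M" unfolding B2 M using \<epsilon> x by (intro mult_left_mono powr_mono) auto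
    have M0: "0 \<le> M" by (simp add: M)
    have "2 * x powr (1 + \<epsilon>/4) * B + 2 * B\<^sup>2 \<le> 2 * (C * M) + 2 * (C\<^sup>2 * M)" using 1 2 by simp
    also have "\<dots> = (2 * C + 2 * C\<^sup>2) * M" by (simp add: algebra_simps)
    also have "\<dots> \<le> (6 + 4 * C + 6 * C\<^sup>2) * M"
      using c M0 by (intro mult_right_mono) (auto intro: add_mono)
    finally show ?thesis using main by linarith
  qed
qed

text \<open>The constant \<open>6 + 4C + 6C\<^sup>2\<close> collects the coefficients of the error terms of \<open>U_error_le\<close>, for
  column degrees that deviate from their mean by at most \<open>C n\<^bsup>1/2+\<epsilon>\<^esup>\<close>.\<close>

definition admissible :: "real \<Rightarrow> real \<Rightarrow> real \<Rightarrow> nat \<Rightarrow> nat \<Rightarrow> bool" where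
  "admissible \<epsilon> c C m n \<longleftrightarrow> n \<ge> 3 \<and> m \<ge> 3 \<and> real n \<le> real m powr (1 + \<epsilon>) \<and> real m \<le> real n powr (1 + \<epsilon>) \<and>
     (6 + 4 * C + 6 * C\<^sup>2) * ln (real n) \<le> c * real n powr (\<epsilon>/2)"

text \<open>The exponent is b^2/(4n) for the clipping level b = n^(1/2 + \<epsilon>/4); the cubic
  factor comes from the union bound over stages and rows, since m n \<le> n^3.\<close>

definition failure_bound :: "real \<Rightarrow> nat \<Rightarrow> real" where
  "failure_bound \<epsilon> n = 4 * real n ^ 3 * exp (- (real n powr (\<epsilon>/2)) / 4)"

lemma model_t_U_failure:
  assumes \<epsilon>: "0 < \<epsilon>" "\<epsilon> \<le> 1/8" and c: "c > 0" "C > 0" and adm: "admissible \<epsilon> c C m n"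
    and A: "host m n A r" and t: "\<And>j. j \<in> {1..n} \<Longrightarrow> t j \<le> r"
      "\<And>j. j \<in> {1..n} \<Longrightarrow> \<bar>real (t j) - real m * lambda_vec m n t\<bar> \<le> C * real n powr (1/2 + \<epsilon>)"
    and l: "c / ln (real n) \<le> lambda_vec m n t * (1 - lambda_vec m n t)"
  shows "measure_pmf.prob (model_t A n t)
      {G. \<not> \<bar>U_dev m n G - var_scale m n G\<bar> \<le> real n powr (-1/2 + 2 * \<epsilon>) * \<bar>var_scale m n G\<bar>}
    \<le> failure_bound \<epsilon> n" (is "measure_pmf.prob _ ?E \<le> _")
proof -
  let ?x = "real n" and ?l = "lambda_vec m n t"
  define B where "B = C * ?x powr (1/2 + \<epsilon>)"
  \<comment> \<open>These b and y make the two exponents of \<open>model_t_U_tail\<close>, b^2/(4n)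
    and y^2/(4 n b^2 m), equal to n^(\<epsilon>/2)/4 and n^(\<epsilon>/2).\<close>
  define b where "b = ?x powr (1/2 + \<epsilon>/4)"
  define y where "y = 2 * ?x powr (1 + \<epsilon>/2) * sqrt (real m)"
  have n: "n \<ge> 3" and m: "m \<ge> 3" and nm: "?x \<le> real m powr (1 + \<epsilon>)" "real m \<le> ?x powr (1 + \<epsilon>)"
    and K: "(6 + 4 * C + 6 * C\<^sup>2) * ln ?x \<le> c * ?x powr (\<epsilon>/2)"
    using adm by (auto simp: admissible_def)
  have x: "?x \<ge> 3" using n by simp
  have \<mu>: "?x powr (1 - \<epsilon>) \<le> real m" using nm m n \<epsilon> by (intro powr_comparable) auto
  have B0: "B \<ge> 0" using c by (simp add: B_def)
  have b0: "b > 0" "b \<le> 2 * ?x"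
  proof -
    show "b > 0" using x by (simp add: b_def)
    have "b \<le> ?x powr 1" unfolding b_def using x \<epsilon> by (intro powr_mono) auto
    then show "b \<le> 2 * ?x" using x by simp
  qed
  have y0: "y \<ge> 0" by (simp add: y_def)
  have y1: "y \<le> 2 * ?x * b * real m"
  proof -
    have "?x powr (1 + \<epsilon>/2) \<le> ?x powr (1 + (1/2 + \<epsilon>/4))" using x \<epsilon> by (intro powr_mono) auto
    also have "\<dots> = ?x powr 1 * b" unfolding b_def by (rule powr_add)
    also have "\<dots> = ?x * b" using x by simp
    finally have 1: "?x powr (1 + \<epsilon>/2) \<le> ?x * b" .
    have "sqrt (real m) * 1 \<le> sqrt (real m) * sqrt (real m)" using m by (intro mult_left_mono) auto
    then have "sqrt (real m) \<le> real m" by simp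
    then have "?x powr (1 + \<epsilon>/2) * sqrt (real m) \<le> ?x * b * real m"
      using 1 x b0 by (intro mult_mono) auto
    then show ?thesis by (simp add: y_def)
  qed
  let ?err = "2 * y + 4 * b * B + 4 * B\<^sup>2 / real m + 2 * ?x + 2 * ?x * B\<^sup>2 / real m"
  have err: "?err \<le> ?x powr (-1/2 + 2 * \<epsilon>) * (?l * (1 - ?l) * real m * ?x)"
    using U_error_le(1)[OF \<epsilon> c x \<mu> K l] by (simp add: B_def b_def y_def)
  have l0: "0 \<le> ?l * (1 - ?l) * real m * ?x"
  proof -
    have "0 \<le> c / ln ?x" using c x by simp
    then show ?thesis using l by simp
  qed
  have "measure_pmf.prob (model_t A n t) ?E = measure_pmf.prob (model_t A n t) (?E \<inter> set_pmf (model_t A n t))"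
    by (simp add: measure_Int_set_pmf)
  also have "\<dots> \<le> measure_pmf.prob (model_t A n t) {G. \<bar>U_dev m n G - var_scale m n G\<bar> > ?err}"
  proof (intro measure_pmf.finite_measure_mono subsetI)
    fix G assume G: "G \<in> ?E \<inter> set_pmf (model_t A n t)"
    have dens: "edge_density m n G = ?l" using G by (intro model_t_edge_density[OF A t(1)]) auto
    have "var_scale m n G = ?l * (1 - ?l) * real m * ?x" by (simp add: var_scale_def dens)
    then show "G \<in> {G. \<bar>U_dev m n G - var_scale m n G\<bar> > ?err}"
      using G err l0 by auto
  qed auto
  also have "\<dots> \<le> 2 * real m * ?x * exp (- b\<^sup>2 / (4 * ?x)) + 2 * exp (- y\<^sup>2 / (4 * ?x * (b\<^sup>2 * real m)))"
    using n m t B0 b0 y0 y1 by (intro model_t_U_tail[OF A]) (auto simp: B_def)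
  also have "- b\<^sup>2 / (4 * ?x) = - (?x powr (\<epsilon>/2)) / 4"
  proof -
    have "b\<^sup>2 = ?x powr (\<epsilon>/2) * ?x"
      unfolding b_def power2_eq_square powr_add[symmetric]
      using powr_add[of ?x "\<epsilon>/2" 1] x by (simp add: add_divide_distrib add.commute)
    then show ?thesis using x by simp
  qed
  also have "- y\<^sup>2 / (4 * ?x * (b\<^sup>2 * real m)) = - (?x powr (\<epsilon>/2))"
  proof -
    have "?x powr (1 + \<epsilon>/2) * ?x powr (1 + \<epsilon>/2) = ?x powr (\<epsilon>/2) * ?x * b\<^sup>2"
    proof -
      have "?x powr (\<epsilon>/2) * ?x powr 1 * (b * b) = ?x powr (1 + \<epsilon>/2) * ?x powr (1 + \<epsilon>/2)"
        unfolding b_def powr_add[symmetric] by (simp add: algebra_simps)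
      then show ?thesis using x by (simp add: power2_eq_square)
    qed
    then have "y\<^sup>2 = 4 * (?x powr (\<epsilon>/2) * ?x * b\<^sup>2) * real m"
      by (simp add: y_def power_mult_distrib power2_eq_square[of "?x powr (1 + \<epsilon>/2)"])
    then show ?thesis using x m b0 by (simp add: field_simps)
  qed
  also have "2 * real m * ?x * exp (- (?x powr (\<epsilon>/2)) / 4) + 2 * exp (- (?x powr (\<epsilon>/2)))
      \<le> failure_bound \<epsilon> n"
  proof -
    have "?x powr (1 + \<epsilon>) \<le> ?x powr 2" using x \<epsilon> by (intro powr_mono) auto
    also have "\<dots> = ?x ^ 2" using x by simp
    finally have "real m \<le> ?x ^ 2" by (rule order_trans[OF nm(2)])
    then have 1: "real m * ?x * exp (- (?x powr (\<epsilon>/2)) / 4) \<le> ?x ^ 2 * ?x * exp (- (?x powr (\<epsilon>/2)) / 4)"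
      by (intro mult_right_mono) auto
    have "1 * exp (- (?x powr (\<epsilon>/2))) \<le> ?x ^ 3 * exp (- (?x powr (\<epsilon>/2)) / 4)"
      using x by (intro mult_mono one_le_power) auto
    then show ?thesis using 1 by (simp add: failure_bound_def power3_eq_cube power2_eq_square)
  qed
  finally show ?thesis .
qed

lemma model_t_UV_failure:
  assumes \<epsilon>: "0 < \<epsilon>" "\<epsilon> \<le> 1/8" and c: "c > 0" "C > 0" and adm: "admissible \<epsilon> c C n n"
    and A: "host n n A r" and t: "\<And>j. j \<in> {1..n} \<Longrightarrow> t j \<le> r"
      "\<And>j. j \<in> {1..n} \<Longrightarrow> \<bar>real (t j) - real n * lambda_vec n n t\<bar> \<le> C * real n powr (1/2 + \<epsilon>)"
    and l: "c / ln (real n) \<le> lambda_vec n n t * (1 - lambda_vec n n t)"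
  shows "measure_pmf.prob (model_t A n t)
      {G. \<not> \<bar>UV_dev n G\<bar> \<le> real n powr (-1/2 + 2 * \<epsilon>) * \<bar>var_scale n n G\<bar>}
    \<le> failure_bound \<epsilon> n" (is "measure_pmf.prob _ ?E \<le> _")
proof -
  let ?x = "real n" and ?l = "lambda_vec n n t"
  define B where "B = C * ?x powr (1/2 + \<epsilon>)"
  \<comment> \<open>Chosen so that y^2/(4 n^2 B^2) = n^(\<epsilon>/2).\<close>
  define y where "y = 2 * ?x powr (1 + \<epsilon>/4) * B"
  have n: "n \<ge> 3" and nm: "?x \<le> ?x powr (1 + \<epsilon>)"
    and K: "(6 + 4 * C + 6 * C\<^sup>2) * ln ?x \<le> c * ?x powr (\<epsilon>/2)"
    using adm by (auto simp: admissible_def)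
  have x: "?x \<ge> 3" using n by simp
  have \<mu>: "?x powr (1 - \<epsilon>) \<le> ?x" using nm n \<epsilon> by (intro powr_comparable) auto
  have B0: "B > 0" using c x by (simp add: B_def)
  have y0: "y \<ge> 0" using B0 by (simp add: y_def)
  have y1: "y \<le> 2 * ?x * B * ?x"
  proof -
    have "?x powr (1 + \<epsilon>/4) \<le> ?x powr (1 + 1)" using x \<epsilon> by (intro powr_mono) auto
    also have "\<dots> = ?x * ?x" using x unfolding powr_add by simp
    finally have "?x powr (1 + \<epsilon>/4) * B \<le> ?x * ?x * B" using B0 by (intro mult_right_mono) auto
    then show ?thesis by (simp add: y_def mult_ac)
  qed
  have err: "y + 2 * B\<^sup>2 \<le> ?x powr (-1/2 + 2 * \<epsilon>) * (?l * (1 - ?l) * ?x * ?x)"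
    using U_error_le(2)[OF \<epsilon> c x \<mu> K l] by (simp add: B_def y_def)
  have l0: "0 \<le> ?l * (1 - ?l) * ?x * ?x"
  proof -
    have "0 \<le> c / ln ?x" using c x by simp
    then show ?thesis using l by simp
  qed
  have "measure_pmf.prob (model_t A n t) ?E = measure_pmf.prob (model_t A n t) (?E \<inter> set_pmf (model_t A n t))"
    by (simp add: measure_Int_set_pmf)
  also have "\<dots> \<le> measure_pmf.prob (model_t A n t) {G. \<bar>UV_dev n G\<bar> > y + 2 * B\<^sup>2}"
  proof (intro measure_pmf.finite_measure_mono subsetI)
    fix G assume G: "G \<in> ?E \<inter> set_pmf (model_t A n t)"
    have dens: "edge_density n n G = ?l" using G by (intro model_t_edge_density[OF A t(1)]) auto
    have "var_scale n n G = ?l * (1 - ?l) * ?x * ?x" by (simp add: var_scale_def dens)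
    then show "G \<in> {G. \<bar>UV_dev n G\<bar> > y + 2 * B\<^sup>2}"
      using G err l0 by auto
  qed auto
  also have "\<dots> \<le> 2 * exp (- y\<^sup>2 / (4 * ?x * (B\<^sup>2 * ?x)))"
    using n t B0 y0 y1 by (intro model_t_UV_tail[OF A]) (auto simp: B_def)
  also have "- y\<^sup>2 / (4 * ?x * (B\<^sup>2 * ?x)) = - (?x powr (\<epsilon>/2))"
  proof -
    have "?x powr (\<epsilon>/2) * ?x powr 1 * ?x powr 1 = ?x powr (1 + \<epsilon>/4) * ?x powr (1 + \<epsilon>/4)"
      unfolding powr_add[symmetric] by (simp add: algebra_simps)
    then have "y\<^sup>2 = 4 * (?x powr (\<epsilon>/2) * ?x * ?x) * B\<^sup>2"
      using x by (simp add: y_def power_mult_distrib power2_eq_square[of "?x powr (1 + \<epsilon>/4)"])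
    then show ?thesis using x B0 by (simp add: field_simps)
  qed
  also have "2 * exp (- (?x powr (\<epsilon>/2))) \<le> failure_bound \<epsilon> n"
  proof -
    have "2 * exp (- (?x powr (\<epsilon>/2))) \<le> (4 * ?x ^ 3) * exp (- (?x powr (\<epsilon>/2)) / 4)"
    proof (intro mult_mono)
      have "1 \<le> ?x ^ 3" using x by (intro one_le_power) simp
      then show "2 \<le> 4 * ?x ^ 3" by simp
    qed auto
    then show ?thesis by (simp add: failure_bound_def)
  qed
  finally show ?thesis .
qed

subsection \<open>Edge-exchangeable models\<close>

text \<open>The features common to \<open>model_p\<close> and \<open>model_k\<close> of expected density \<open>q\<close>: the weight of a graph
  depends only on its number of edges (so that fixing all column degrees yields \<open>model_t\<close>), and
  exponential moments are dominated by those of independent Poisson variables.\<close>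

definition edge_exchangeable :: "(nat \<times> nat) set \<Rightarrow> real \<Rightarrow> bigraph pmf \<Rightarrow> bool" where
  "edge_exchangeable A q D \<longleftrightarrow> set_pmf D \<subseteq> Pow A \<and>
     (\<exists>w. \<forall>G\<in>Pow A. pmf D G = w (card G)) \<and>
     (\<forall>x :: nat \<times> nat \<Rightarrow> real. (\<forall>e\<in>A. x e \<ge> 0) \<longrightarrow>
        measure_pmf.expectation D (\<lambda>G. \<Prod>e\<in>G. x e) \<le> exp (q * (\<Sum>e\<in>A. x e - 1)))"

text \<open>A uniform k-subset of A is the situation of Maclaurin's bound, with edges in place of
  rows.\<close>

lemma edge_exchangeable_model_k:
  assumes "finite A" "k \<le> card A"
  shows "edge_exchangeable A (real k / real (card A)) (model_k A k)"
proof -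
  let ?S = "{G. G \<subseteq> A \<and> card G = k}"
  note ne = subsets_card_nonempty[OF assms]
  have "pmf (model_k A k) G = (if card G = k then 1 / real (card ?S) else 0)" if "G \<in> Pow A" for G
    using that ne by (simp add: model_k_def pmf_of_set indicator_def)
  then have "\<exists>w. \<forall>G\<in>Pow A. pmf (model_k A k) G = w (card G)"
    by (intro exI[of _ "\<lambda>i. if i = k then 1 / real (card ?S) else 0"]) auto
  moreover have "set_pmf (model_k A k) \<subseteq> Pow A" using ne by (auto simp: model_k_def)
  ultimately show ?thesis
    unfolding edge_exchangeable_def
    using expectation_prod_random_subset_le[OF assms] by (auto simp: model_k_def)
qed

lemma edge_exchangeable_model_p:
  assumes A: "finite A" and p: "0 \<le> p" "p \<le> 1"
  shows "edge_exchangeable A p (model_p A p)"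
proof -
  let ?P = "Pi_pmf A False (\<lambda>_. bernoulli_pmf p)"
  let ?g = "\<lambda>f. {e \<in> A. f e}"
  have supp: "\<And>f e. f \<in> set_pmf ?P \<Longrightarrow> e \<notin> A \<Longrightarrow> f e = False"
    using set_Pi_pmf_subset[OF A, of False "\<lambda>_. bernoulli_pmf p"] by blast
  have "pmf (model_p A p) G = p ^ card G * (1 - p) ^ (card A - card G)" if G: "G \<in> Pow A" for G
  proof -
    \<comment> \<open>Functions in the support vanish off A, so the graph determines the
      function.\<close>
    have "?g -` {G} \<inter> set_pmf ?P = {\<lambda>e. e \<in> G} \<inter> set_pmf ?P"
      using G supp by (fastforce simp: fun_eq_iff)
    then have "measure_pmf.prob ?P (?g -` {G}) = measure_pmf.prob ?P {\<lambda>e. e \<in> G}"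
      using measure_Int_set_pmf[of ?P "?g -` {G}"] measure_Int_set_pmf[of ?P "{\<lambda>e. e \<in> G}"] by simp
    then have "pmf (model_p A p) G = pmf ?P (\<lambda>e. e \<in> G)"
      unfolding model_p_def pmf_map by (simp add: measure_pmf_single)
    also have "\<dots> = (\<Prod>e\<in>A. pmf (bernoulli_pmf p) (e \<in> G))"
      using G A by (subst pmf_Pi') auto
    also have "\<dots> = (\<Prod>e\<in>A. if e \<in> G then p else 1 - p)"
      using p by (intro prod.cong) auto
    also have "\<dots> = p ^ card (A \<inter> G) * (1 - p) ^ card (A - G)"
      using A by (simp add: prod.If_cases Diff_eq)
    also have "A \<inter> G = G" using G by auto
    also have "card (A - G) = card A - card G" using G A by (simp add: card_Diff_subset finite_subset)
    finally show ?thesis .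
  qed
  then have "\<exists>w. \<forall>G\<in>Pow A. pmf (model_p A p) G = w (card G)"
    by (intro exI[of _ "\<lambda>i. p ^ i * (1 - p) ^ (card A - i)"]) auto
  moreover have "set_pmf (model_p A p) \<subseteq> Pow A" by (auto simp: model_p_def)
  moreover have "measure_pmf.expectation (model_p A p) (\<lambda>G. \<Prod>e\<in>G. x e) \<le> exp (p * (\<Sum>e\<in>A. x e - 1))"
    if x: "\<forall>e\<in>A. x e \<ge> 0" for x :: "nat \<times> nat \<Rightarrow> real"
  proof -
    have "measure_pmf.expectation (model_p A p) (\<lambda>G. \<Prod>e\<in>G. x e)
        = measure_pmf.expectation ?P (\<lambda>f. \<Prod>e\<in>A. if f e then x e else 1)"
      unfolding model_p_def integral_map_pmf
      using A by (intro Bochner_Integration.integral_cong refl) (simp add: prod.inter_filter)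
    also have "\<dots> = (\<Prod>e\<in>A. measure_pmf.expectation (bernoulli_pmf p) (\<lambda>b. if b then x e else 1))"
      using A x by (intro expectation_prod_Pi_pmf[of A _ "\<lambda>e b. if b then x e else 1"])
        (auto intro: integrable_measure_pmf_finite)
    also have "\<dots> = (\<Prod>e\<in>A. 1 + p * (x e - 1))"
      using p by (intro prod.cong) (auto simp: algebra_simps)
    also have "\<dots> \<le> (\<Prod>e\<in>A. exp (p * (x e - 1)))"
    proof (intro prod_mono conjI)
      fix e assume "e \<in> A"
      then have "p * 0 \<le> p * x e" using x p by (intro mult_left_mono) auto
      then show "0 \<le> 1 + p * (x e - 1)" using p by (simp add: algebra_simps)
    qed auto
    also have "\<dots> = exp (p * (\<Sum>e\<in>A. x e - 1))"
      using A by (simp add: exp_sum sum_distrib_left)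
    finally show ?thesis .
  qed
  ultimately show ?thesis unfolding edge_exchangeable_def by blast
qed

lemma edge_exchangeable_converse:
  assumes "edge_exchangeable A q D"
  shows "edge_exchangeable (A\<inverse>) q (map_pmf converse D)"
proof -
  obtain w where w: "\<And>G. G \<subseteq> A \<Longrightarrow> pmf D G = w (card G)"
    using assms unfolding edge_exchangeable_def by blast
  have inj: "inj (converse :: (nat \<times> nat) set \<Rightarrow> _)" by (simp add: inj_on_def)
  have "pmf (map_pmf converse D) G = w (card G)" if "G \<subseteq> A\<inverse>" for G
  proof -
    have "pmf (map_pmf converse D) (converse (G\<inverse>)) = pmf D (G\<inverse>)" by (rule pmf_map_inj'[OF inj])
    also have "\<dots> = w (card (G\<inverse>))" using that by (intro w) auto
    finally show ?thesis by simp
  qed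
  moreover have "set_pmf (map_pmf converse D) \<subseteq> Pow (A\<inverse>)"
    using assms unfolding edge_exchangeable_def by auto
  moreover have "measure_pmf.expectation (map_pmf converse D) (\<lambda>G. \<Prod>e\<in>G. x e)
      \<le> exp (q * (\<Sum>e\<in>A\<inverse>. x e - 1))"
    if x: "\<forall>e\<in>A\<inverse>. x e \<ge> 0" for x :: "nat \<times> nat \<Rightarrow> real"
  proof -
    have conv: "G\<inverse> = prod.swap ` G" for G :: "(nat \<times> nat) set" by auto
    have injs: "inj_on prod.swap (G :: (nat \<times> nat) set)" for G by (auto simp: inj_on_def)
    have "measure_pmf.expectation D (\<lambda>G. \<Prod>e\<in>G. x (prod.swap e))
        \<le> exp (q * (\<Sum>e\<in>A. x (prod.swap e) - 1))"
    proof -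
      have "\<forall>x :: nat \<times> nat \<Rightarrow> real. (\<forall>e\<in>A. x e \<ge> 0) \<longrightarrow>
          measure_pmf.expectation D (\<lambda>G. \<Prod>e\<in>G. x e) \<le> exp (q * (\<Sum>e\<in>A. x e - 1))"
        using assms unfolding edge_exchangeable_def by blast
      then show ?thesis using x by (elim allE[of _ "\<lambda>e. x (prod.swap e)"]) auto
    qed
    then show ?thesis
      unfolding integral_map_pmf conv by (simp add: prod.reindex[OF injs] sum.reindex[OF injs])
  qed
  ultimately show ?thesis unfolding edge_exchangeable_def by blast
qed

text \<open>With weight exp s on the edges of column j and 1 elsewhere, the product over a graph is
  exp (s T_j), so the product bound in \<open>edge_exchangeable\<close> becomes a bound on a moment
  generating function.\<close>

lemma deg_v_tail:
  assumes A: "host m n A r" and D: "edge_exchangeable A q D" and q: "0 \<le> q" "q \<le> 1"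
    and j: "j \<in> {1..n}" and m: "m \<ge> 2" and x: "0 \<le> x" "x \<le> 2 * real m"
  shows "measure_pmf.prob D {G. \<bar>real (deg_v G j) - real r * q\<bar> > x} \<le> 2 * exp (- x\<^sup>2 / (4 * real m))"
proof -
  note r = host_bounds[OF A m]
  have finA: "finite A" by (rule finite_host[OF A])
  have supp: "set_pmf D \<subseteq> Pow A" using D by (simp add: edge_exchangeable_def)
  have finD: "finite (set_pmf D)" using finite_subset[OF supp] finA by simp
  \<comment> \<open>The minimiser of m \<theta>^2 - \<theta> x; the range of x keeps it at most
    1.\<close>
  define \<theta> where "\<theta> = x / (2 * real m)"
  have \<theta>: "0 \<le> \<theta>" "\<theta> \<le> 1" using x m by (auto simp: \<theta>_def divide_le_eq)
  have mgf: "measure_pmf.expectation D (\<lambda>G. exp (s * (real (deg_v G j) - real r * q)))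
      \<le> exp (real m * \<theta>\<^sup>2)" if s: "\<bar>s\<bar> = \<theta>" for s
  proof -
    let ?x = "\<lambda>e :: nat \<times> nat. if snd e = j then exp s else 1"
    have colcard: "card {e \<in> G. snd e = j} = deg_v G j" for G
    proof -
      have "{e \<in> G. snd e = j} = (\<lambda>i. (i, j)) ` {i. (i, j) \<in> G}" by force
      then show ?thesis unfolding deg_v_def by (simp add: card_image inj_on_def)
    qed
    have prod: "exp (s * (real (deg_v G j) - real r * q))
        = exp (- s * real r * q) * (\<Prod>e\<in>G. ?x e)" if "G \<subseteq> A" for G
    proof -
      have fG: "finite G" using that finA finite_subset by blast
      have "(\<Prod>e\<in>G. ?x e) = (\<Prod>e\<in>{e \<in> G. snd e = j}. exp s)"
        by (rule prod.inter_filter[OF fG, symmetric])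
      also have "\<dots> = exp (s * real (deg_v G j))"
        by (simp add: colcard exp_of_nat2_mult)
      finally show ?thesis by (simp add: right_diff_distrib exp_diff exp_minus field_simps)
    qed
    have sumA: "(\<Sum>e\<in>A. ?x e - 1) = real r * (exp s - 1)"
    proof -
      have "(\<Sum>e\<in>A. ?x e - 1) = (\<Sum>e\<in>{e \<in> A. snd e = j}. exp s - 1)"
        using finA by (subst sum.inter_filter) (auto intro!: sum.cong)
      then show ?thesis
        by (simp add: colcard deg_v_eq_card_column card_column_host[OF A j])
    qed
    have "measure_pmf.expectation D (\<lambda>G. exp (s * (real (deg_v G j) - real r * q)))
        = measure_pmf.expectation D (\<lambda>G. exp (- s * real r * q) * (\<Prod>e\<in>G. ?x e))"
      using supp prod by (intro integral_cong_AE) (auto simp: AE_measure_pmf_iff)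
    also have "\<dots> = exp (- s * real r * q) * measure_pmf.expectation D (\<lambda>G. \<Prod>e\<in>G. ?x e)" by simp
    also have "\<dots> \<le> exp (- s * real r * q) * exp (q * (real r * (exp s - 1)))"
    proof (intro mult_left_mono)
      have "measure_pmf.expectation D (\<lambda>G. \<Prod>e\<in>G. ?x e) \<le> exp (q * (\<Sum>e\<in>A. ?x e - 1))"
        using D unfolding edge_exchangeable_def by simp
      then show "measure_pmf.expectation D (\<lambda>G. \<Prod>e\<in>G. ?x e) \<le> exp (q * (real r * (exp s - 1)))"
        unfolding sumA .
    qed simp
    also have "\<dots> = exp (real r * q * (exp s - 1 - s))"
      by (simp add: algebra_simps flip: exp_add)
    also have "\<dots> \<le> exp (real m * \<theta>\<^sup>2)"
    proof -
      have "exp s - 1 - s \<le> s\<^sup>2" using exp_le_quadratic[of s] s \<theta> by simp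
      also have "s\<^sup>2 = \<theta>\<^sup>2" using s by (metis power2_abs)
      finally have 1: "exp s - 1 - s \<le> \<theta>\<^sup>2" .
      have "real r * q \<le> real m * 1" using r q by (intro mult_mono) auto
      moreover have "0 \<le> exp s - 1 - s" using exp_ge_add_one_self[of s] by linarith
      ultimately have "(real r * q) * (exp s - 1 - s) \<le> (real m * 1) * \<theta>\<^sup>2"
        using 1 by (intro mult_mono[of "real r * q" "real m * 1"]) auto
      then show ?thesis by simp
    qed
    finally show ?thesis .
  qed
  have "measure_pmf.prob D {G. \<bar>real (deg_v G j) - real r * q\<bar> > x}
      \<le> 2 * exp (real m * \<theta>\<^sup>2) * exp (- \<theta> * x)"
    using mgf[of \<theta>] mgf[of "-\<theta>"] \<theta> by (intro chernoff_abs_pmf finD) auto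
  also have "\<dots> = 2 * exp (real m * \<theta>\<^sup>2 - \<theta> * x)"
    by (simp add: exp_diff exp_minus field_simps)
  also have "real m * \<theta>\<^sup>2 - \<theta> * x = - x\<^sup>2 / (4 * real m)"
    using m by (simp add: \<theta>_def field_simps power2_eq_square)
  finally show ?thesis .
qed

section \<open>Conditioning on the column degrees\<close>

text \<open>Subgraphs of A with the same column degrees have the same number of edges, hence the
  same weight, so each fibre of \<open>deg_v\<close> carries a multiple of the uniform law
  \<open>model_t\<close>. Summing the bound over the fibres that satisfy R avoids any division by
  the probability of a fibre.\<close>

lemma prob_le_conditioned_on_columns:
  assumes A: "host m n A r" and D: "edge_exchangeable A q D" and \<delta>: "\<delta> \<ge> 0"
    and cond: "\<And>G. G \<subseteq> A \<Longrightarrow> R (deg_v G) \<Longrightarrow> measure_pmf.prob (model_t A n (deg_v G)) E \<le> \<delta>"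
  shows "measure_pmf.prob D (E \<inter> {G. R (deg_v G)}) \<le> \<delta>"
proof -
  have finA: "finite A" by (rule finite_host[OF A])
  have Asub: "A \<subseteq> UNIV \<times> {1..n}" using host_subset[OF A] by blast
  have supp: "set_pmf D \<subseteq> Pow A" using D by (simp add: edge_exchangeable_def)
  obtain w where w: "\<And>G. G \<subseteq> A \<Longrightarrow> pmf D G = w (card G)"
    using D unfolding edge_exchangeable_def by blast
  \<comment> \<open>Fibres are taken over whole functions \<open>deg_v G\<close>, whereas
    \<open>model_t\<close> prescribes degrees on 1..n; elsewhere they vanish.\<close>
  have deg0: "deg_v G j = 0" if "G \<subseteq> A" "j \<notin> {1..n}" for G j
  proof -
    have "{i. (i, j) \<in> G} = {}" using that Asub by blast
    then show ?thesis by (simp add: deg_v_def)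
  qed
  define S where "S = {G \<in> Pow A. R (deg_v G)}"
  have finS: "finite S" using finA by (simp add: S_def)
  define T where "T = deg_v ` S"
  have finT: "finite T" using finS by (simp add: T_def)
  have fiber: "(\<Sum>G\<in>{G \<in> E \<inter> S. deg_v G = t}. pmf D G) \<le> \<delta> * (\<Sum>G\<in>{G \<in> S. deg_v G = t}. pmf D G)"
    if t: "t \<in> T" for t
  proof -
    obtain G0 where G0: "G0 \<subseteq> A" "R (deg_v G0)" "t = deg_v G0"
      using t by (auto simp: T_def S_def)
    have cls: "{G \<in> S. deg_v G = t} = {G. G \<subseteq> A \<and> (\<forall>j\<in>{1..n}. deg_v G j = t j)}" (is "?S = ?C")
    proof
      show "?S \<subseteq> ?C" by (auto simp: S_def)
      show "?C \<subseteq> ?S"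
      proof
        fix G assume G: "G \<in> ?C"
        have "deg_v G = t"
        proof
          fix j show "deg_v G j = t j"
            using G deg0[of G j] deg0[of G0 j] G0 by (cases "j \<in> {1..n}") auto
        qed
        then show "G \<in> ?S" using G G0 by (simp add: S_def)
      qed
    qed
    have finC: "finite ?C" using finA by simp
    have neC: "?C \<noteq> {}" using G0 by blast
    define \<kappa> where "\<kappa> = (\<Sum>j=1..n. t j)"
    have pmfC: "pmf D G = w \<kappa>" if "G \<in> ?C" for G
    proof -
      have "card G = (\<Sum>j=1..n. card (column G j))"
        using that Asub finA finite_subset by (intro card_eq_sum_column) auto
      also have "\<dots> = \<kappa>" unfolding \<kappa>_def using that
        by (intro sum.cong) (auto simp: deg_v_eq_card_column)
      finally show ?thesis using w that by simp
    qed
    have w0: "w \<kappa> \<ge> 0" using pmfC[of G0] pmf_nonneg[of D G0] G0 by simp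
    have cnt: "real (card (?C \<inter> E)) \<le> \<delta> * real (card ?C)"
    proof -
      have "measure_pmf.prob (model_t A n t) E = real (card (?C \<inter> E)) / real (card ?C)"
        unfolding model_t_def by (rule measure_pmf_of_set[OF neC finC])
      moreover have "measure_pmf.prob (model_t A n t) E \<le> \<delta>" using cond G0 by simp
      moreover have "real (card ?C) > 0" using finC neC by (simp add: card_gt_0_iff)
      ultimately show ?thesis by (simp add: divide_le_eq)
    qed
    have "{G \<in> E \<inter> S. deg_v G = t} = ?C \<inter> E" using cls by blast
    then have "(\<Sum>G\<in>{G \<in> E \<inter> S. deg_v G = t}. pmf D G) = real (card (?C \<inter> E)) * w \<kappa>"
      using pmfC by simp
    also have "\<dots> \<le> (\<delta> * real (card ?C)) * w \<kappa>" using cnt w0 by (intro mult_right_mono)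
    also have "\<dots> = \<delta> * (\<Sum>G\<in>?C. pmf D G)" using pmfC by simp
    finally show ?thesis unfolding cls .
  qed
  have "measure_pmf.prob D (E \<inter> {G. R (deg_v G)}) = measure_pmf.prob D (E \<inter> {G. R (deg_v G)} \<inter> set_pmf D)"
    by (simp add: measure_Int_set_pmf)
  also have "\<dots> \<le> measure_pmf.prob D (E \<inter> S)"
    using supp by (intro measure_pmf.finite_measure_mono) (auto simp: S_def)
  also have "\<dots> = (\<Sum>G\<in>E \<inter> S. pmf D G)"
    using finS by (simp add: measure_measure_pmf_finite)
  also have "\<dots> = (\<Sum>t\<in>T. \<Sum>G\<in>{G \<in> E \<inter> S. deg_v G = t}. pmf D G)"
    using finS finT by (intro sum.group[symmetric]) (auto simp: T_def)
  also have "\<dots> \<le> (\<Sum>t\<in>T. \<delta> * (\<Sum>G\<in>{G \<in> S. deg_v G = t}. pmf D G))"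
    by (intro sum_mono fiber)
  also have "\<dots> = \<delta> * (\<Sum>G\<in>S. pmf D G)"
    unfolding sum_distrib_left[symmetric] using finS finT
    by (subst sum.group) (auto simp: T_def)
  also have "\<dots> \<le> \<delta> * 1"
  proof (intro mult_left_mono \<delta>)
    have "(\<Sum>G\<in>S. pmf D G) = measure_pmf.prob D S" using finS by (simp add: measure_measure_pmf_finite)
    then show "(\<Sum>G\<in>S. pmf D G) \<le> 1" by simp
  qed
  finally show ?thesis by simp
qed

lemma abs_diff_variance_le:
  fixes p q :: real
  assumes "0 \<le> p" "p \<le> 1" "0 \<le> q" "q \<le> 1"
  shows "\<bar>p * (1 - p) - q * (1 - q)\<bar> \<le> \<bar>p - q\<bar>"
proof -
  have "p * (1 - p) - q * (1 - q) = (p - q) * (1 - p - q)" by (simp add: algebra_simps)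
  moreover have "\<bar>p - q\<bar> * \<bar>1 - p - q\<bar> \<le> \<bar>p - q\<bar> * 1"
    using assms by (intro mult_left_mono) auto
  ultimately show ?thesis by (simp add: abs_mult)
qed

text \<open>If all column degrees lie within x of the expected r q, so does their average m l, which
  gives deviations of at most 2x from the average. Passing from r q to m q costs at most 1 \<le> x,
  so l and q differ by at most 2x/m.\<close>

lemma regular_columns_parameters:
  assumes A: "host m n A r" and m: "m \<ge> 2" and n: "n > 0" and q: "0 \<le> q" "q \<le> 1" and x: "x \<ge> 1"
    and t: "\<And>j. j \<in> {1..n} \<Longrightarrow> \<bar>real (t j) - real r * q\<bar> \<le> x" "\<And>j. j \<in> {1..n} \<Longrightarrow> t j \<le> r"
  defines "l \<equiv> lambda_vec m n t"
  shows "\<And>j. j \<in> {1..n} \<Longrightarrow> \<bar>real (t j) - real m * l\<bar> \<le> 2 * x"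
    and "q * (1 - q) - 2 * x / real m \<le> l * (1 - l)"
proof -
  note r = host_bounds[OF A m]
  define T where "T = (\<Sum>j=1..n. real (t j))"
  have T: "T = real n * (real m * l)" using m n by (simp add: T_def l_def lambda_vec_def)
  have "\<bar>T - real n * (real r * q)\<bar> = \<bar>\<Sum>j=1..n. real (t j) - real r * q\<bar>"
    by (simp add: T_def sum_subtractf)
  also have "\<dots> \<le> (\<Sum>j=1..n. x)" using t by (intro order_trans[OF sum_abs] sum_mono) auto
  also have "\<dots> = real n * x" by simp
  also have "T - real n * (real r * q) = real n * (real m * l - real r * q)"
    unfolding T by (simp add: algebra_simps)
  finally have "real n * \<bar>real m * l - real r * q\<bar> \<le> real n * x" by (simp add: abs_mult)
  then have ml: "\<bar>real m * l - real r * q\<bar> \<le> x" using n by simp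
  show "\<bar>real (t j) - real m * l\<bar> \<le> 2 * x" if "j \<in> {1..n}" for j
    using t(1)[OF that] ml by linarith
  have "\<bar>real m * q - real r * q\<bar> \<le> 1"
  proof -
    have "(real m - real r) * q \<le> 1 * 1" using r q by (intro mult_mono) auto
    moreover have "0 \<le> (real m - real r) * q" using r q by simp
    ultimately show ?thesis by (simp add: left_diff_distrib)
  qed
  then have "\<bar>real m * l - real m * q\<bar> \<le> 2 * x" using ml x by linarith
  moreover have "real m * l - real m * q = real m * (l - q)" by (simp add: algebra_simps)
  ultimately have "real m * \<bar>l - q\<bar> \<le> 2 * x" by (simp add: abs_mult)
  then have lq: "\<bar>l - q\<bar> \<le> 2 * x / real m" using m by (simp add: le_divide_eq mult.commute)
  have l: "0 \<le> l" "l \<le> 1"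
  proof -
    show "0 \<le> l" unfolding l_def lambda_vec_def by (intro divide_nonneg_nonneg sum_nonneg) auto
    have "T \<le> (\<Sum>j=1..n. real m)" unfolding T_def
    proof (intro sum_mono)
      fix j assume "j \<in> {1..n}"
      then show "real (t j) \<le> real m" using t(2)[of j] r(2) by linarith
    qed
    then have "real n * (real m * l) \<le> real n * (real m * 1)" unfolding T by simp
    then show "l \<le> 1" using m n by simp
  qed
  show "q * (1 - q) - 2 * x / real m \<le> l * (1 - l)"
    using abs_diff_variance_le[OF l q] lq by linarith
qed

text \<open>E stands for any event that is rare under every regular degree vector. Irregular vectors
  account for a second \<open>failure_bound\<close>. Of the lower bound 2c / ln n on q (1 - q), one
  half may be lost in passing to the actual density; the 2 in \<open>admissible\<close> is the
  constant from \<open>regular_columns_parameters\<close>.\<close>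

lemma exchangeable_failure:
  assumes \<epsilon>: "0 < \<epsilon>" "\<epsilon> \<le> 1/8" and c: "c > 0" and adm: "admissible \<epsilon> c 2 m n"
    and A: "host m n A r" and D: "edge_exchangeable A q D" and q: "0 \<le> q" "q \<le> 1"
    and qc: "2 * c / ln (real n) \<le> q * (1 - q)"
    and E: "\<And>t. (\<And>j. j \<in> {1..n} \<Longrightarrow> t j \<le> r) \<Longrightarrow>
      (\<And>j. j \<in> {1..n} \<Longrightarrow> \<bar>real (t j) - real m * lambda_vec m n t\<bar> \<le> 2 * real n powr (1/2 + \<epsilon>)) \<Longrightarrow>
      c / ln (real n) \<le> lambda_vec m n t * (1 - lambda_vec m n t) \<Longrightarrow>
      measure_pmf.prob (model_t A n t) E \<le> failure_bound \<epsilon> n"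
  shows "measure_pmf.prob D E \<le> 2 * failure_bound \<epsilon> n"
proof -
  let ?z = "real n"
  define x where "x = ?z powr (1/2 + \<epsilon>)"
  have n: "n \<ge> 3" and m: "m \<ge> 3" and nm: "?z \<le> real m powr (1 + \<epsilon>)" "real m \<le> ?z powr (1 + \<epsilon>)"
    and K: "(6 + 4 * 2 + 6 * 2\<^sup>2) * ln ?z \<le> c * ?z powr (\<epsilon>/2)"
    using adm by (auto simp: admissible_def)
  have z: "?z \<ge> 3" using n by simp
  have lnz: "ln ?z > 0" using z by simp
  have \<mu>: "?z powr (1 - \<epsilon>) \<le> real m" using nm m n \<epsilon> by (intro powr_comparable) auto
  have x1: "x \<ge> 1" unfolding x_def using z \<epsilon> by (intro ge_one_powr_ge_zero) auto
  have xm: "x \<le> 2 * real m"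
  proof -
    have "x \<le> ?z powr (1 - \<epsilon>)" unfolding x_def using z \<epsilon> by (intro powr_mono) auto
    then show ?thesis using \<mu> by linarith
  qed
  have small: "2 * x / real m \<le> c / ln ?z"
  proof -
    have "2 * x * ln ?z = x * (2 * ln ?z)" by simp
    also have "\<dots> \<le> x * (c * ?z powr (\<epsilon>/2))"
      using K lnz x1 by (intro mult_left_mono) auto
    also have "\<dots> = c * ?z powr (1/2 + \<epsilon> + \<epsilon>/2)" unfolding x_def powr_add[of _ "1/2 + \<epsilon>"] by simp
    also have "\<dots> \<le> c * ?z powr (1 - \<epsilon>)" using c z \<epsilon> by (intro mult_left_mono powr_mono) auto
    also have "\<dots> \<le> c * real m" using c \<mu> by (intro mult_left_mono) auto
    finally show ?thesis using lnz m by (simp add: divide_simps mult_ac)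
  qed
  define R where "R = (\<lambda>t :: nat \<Rightarrow> nat. \<forall>j\<in>{1..n}. \<bar>real (t j) - real r * q\<bar> \<le> x)"
  let ?T = "\<lambda>j. {G. \<bar>real (deg_v G j) - real r * q\<bar> > x}"
  have f0: "failure_bound \<epsilon> n \<ge> 0" by (simp add: failure_bound_def)
  have reg: "measure_pmf.prob D (E \<inter> {G. R (deg_v G)}) \<le> failure_bound \<epsilon> n"
  proof (rule prob_le_conditioned_on_columns[OF A D f0])
    fix G assume G: "G \<subseteq> A" "R (deg_v G)"
    have tr: "deg_v G j \<le> r" if "j \<in> {1..n}" for j
    proof -
      have "column G j \<subseteq> column A j" using G by (auto simp: column_def)
      moreover have "finite (column A j)" using column_host_subset[OF A] finite_subset by blast
      ultimately have "card (column G j) \<le> card (column A j)" by (intro card_mono)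
      then show ?thesis using card_column_host[OF A that] by (simp add: deg_v_eq_card_column)
    qed
    have t: "\<bar>real (deg_v G j) - real r * q\<bar> \<le> x" if "j \<in> {1..n}" for j
      using G that by (simp add: R_def)
    have m2: "m \<ge> 2" and n0: "n > 0" using m n by auto
    let ?l = "lambda_vec m n (deg_v G)"
    have par1: "\<bar>real (deg_v G j) - real m * ?l\<bar> \<le> 2 * x" if "j \<in> {1..n}" for j
      by (rule regular_columns_parameters(1)[OF A m2 n0 q x1 t tr that])
    have par2: "q * (1 - q) - 2 * x / real m \<le> ?l * (1 - ?l)"
      by (rule regular_columns_parameters(2)[OF A m2 n0 q x1 t tr])
    have "2 * c / ln ?z = c / ln ?z + c / ln ?z" by simp
    then have "c / ln ?z \<le> q * (1 - q) - 2 * x / real m" using qc small by linarith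
    then have "c / ln ?z \<le> ?l * (1 - ?l)"
      using par2 by linarith
    then show "measure_pmf.prob (model_t A n (deg_v G)) E \<le> failure_bound \<epsilon> n"
      using par1 tr by (intro E) (auto simp: x_def)
  qed
  have irr: "measure_pmf.prob D (\<Union>j\<in>{1..n}. ?T j) \<le> failure_bound \<epsilon> n"
  proof -
    have "measure_pmf.prob D (\<Union>j\<in>{1..n}. ?T j) \<le> (\<Sum>j\<in>{1..n}. measure_pmf.prob D (?T j))"
      by (intro measure_pmf.finite_measure_subadditive_finite) auto
    also have "\<dots> \<le> (\<Sum>j\<in>{1..n}. 2 * exp (- x\<^sup>2 / (4 * real m)))"
      using m x1 xm by (intro sum_mono deg_v_tail[OF A D q]) auto
    also have "\<dots> = 2 * ?z * exp (- x\<^sup>2 / (4 * real m))" by simp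
    also have "\<dots> \<le> 2 * ?z * exp (- (?z powr (\<epsilon>/2)) / 4)"
    proof -
      have "?z powr (\<epsilon>/2) * real m \<le> ?z powr \<epsilon> * ?z powr (1 + \<epsilon>)"
        using nm z \<epsilon> by (intro mult_mono powr_mono) auto
      also have "\<dots> = x\<^sup>2" by (simp add: x_def power2_eq_square algebra_simps flip: powr_add)
      finally have "?z powr (\<epsilon>/2) \<le> x\<^sup>2 / real m" using m by (simp add: le_divide_eq)
      then have "- x\<^sup>2 / (4 * real m) \<le> - (?z powr (\<epsilon>/2)) / 4" by (simp add: field_simps)
      then show ?thesis by (intro mult_left_mono) auto
    qed
    also have "\<dots> \<le> 4 * ?z ^ 3 * exp (- (?z powr (\<epsilon>/2)) / 4)"
    proof (intro mult_right_mono)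
      have "?z ^ 1 \<le> ?z ^ 3" using z by (intro power_increasing) auto
      moreover have "?z ^ 1 = ?z" by (rule power_one_right)
      ultimately show "2 * ?z \<le> 4 * ?z ^ 3" using z by linarith
    qed auto
    finally show ?thesis by (simp add: failure_bound_def)
  qed
  have "measure_pmf.prob D E \<le> measure_pmf.prob D ((E \<inter> {G. R (deg_v G)}) \<union> (\<Union>j\<in>{1..n}. ?T j))"
    by (intro measure_pmf.finite_measure_mono) (auto simp: R_def not_le)
  also have "\<dots> \<le> measure_pmf.prob D (E \<inter> {G. R (deg_v G)}) + measure_pmf.prob D (\<Union>j\<in>{1..n}. ?T j)"
    by (rule measure_Un_le) auto
  finally show ?thesis using reg irr by linarith
qed

lemma exchangeable_U_failure:
  assumes \<epsilon>: "0 < \<epsilon>" "\<epsilon> \<le> 1/8" and c: "c > 0" and adm: "admissible \<epsilon> c 2 m n"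
    and A: "host m n A r" and D: "edge_exchangeable A q D" and q: "0 \<le> q" "q \<le> 1"
    and qc: "2 * c / ln (real n) \<le> q * (1 - q)"
  shows "measure_pmf.prob D
      {G. \<not> \<bar>U_dev m n G - var_scale m n G\<bar> \<le> real n powr (-1/2 + 2 * \<epsilon>) * \<bar>var_scale m n G\<bar>}
    \<le> 2 * failure_bound \<epsilon> n"
  using model_t_U_failure[OF \<epsilon> c _ adm A] by (intro exchangeable_failure[OF \<epsilon> c adm A D q qc]) auto

lemma exchangeable_UV_failure:
  assumes \<epsilon>: "0 < \<epsilon>" "\<epsilon> \<le> 1/8" and c: "c > 0" and adm: "admissible \<epsilon> c 2 n n"
    and A: "host n n A r" and D: "edge_exchangeable A q D" and q: "0 \<le> q" "q \<le> 1"
    and qc: "2 * c / ln (real n) \<le> q * (1 - q)"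
  shows "measure_pmf.prob D
      {G. \<not> \<bar>UV_dev n G\<bar> \<le> real n powr (-1/2 + 2 * \<epsilon>) * \<bar>var_scale n n G\<bar>}
    \<le> 2 * failure_bound \<epsilon> n"
  using model_t_UV_failure[OF \<epsilon> c _ adm A] by (intro exchangeable_failure[OF \<epsilon> c adm A D q qc]) auto

lemma host_converse: "host m n A r \<Longrightarrow> \<exists>r'. host n m (A\<inverse>) r'"
proof -
  have "(all_edges m n)\<inverse> = all_edges n m" "(offdiag_edges n)\<inverse> = offdiag_edges n"
    by (auto simp: all_edges_def offdiag_edges_def)
  then show "host m n A r \<Longrightarrow> \<exists>r'. host n m (A\<inverse>) r'" unfolding host_def by metis
qed

lemma V_dev_eq_U_dev_converse: "V_dev m n G = U_dev n m (G\<inverse>)"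
  by (simp add: V_dev_def U_dev_def deg_u_def deg_v_def edge_density_def mult.commute)

lemma var_scale_converse: "var_scale n m (G\<inverse>) = var_scale m n G"
  by (simp add: var_scale_def edge_density_def mult_ac)

lemma exchangeable_V_failure:
  assumes \<epsilon>: "0 < \<epsilon>" "\<epsilon> \<le> 1/8" and c: "c > 0" and adm: "admissible \<epsilon> c 2 n m"
    and A: "host m n A r" and D: "edge_exchangeable A q D" and q: "0 \<le> q" "q \<le> 1"
    and qc: "2 * c / ln (real m) \<le> q * (1 - q)"
  shows "measure_pmf.prob D
      {G. \<not> \<bar>V_dev m n G - var_scale m n G\<bar> \<le> real m powr (-1/2 + 2 * \<epsilon>) * \<bar>var_scale m n G\<bar>}
    \<le> 2 * failure_bound \<epsilon> m"
proof -
  obtain r' where "host n m (A\<inverse>) r'" using host_converse[OF A] by blast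
  from exchangeable_U_failure[OF \<epsilon> c adm this edge_exchangeable_converse[OF D] q qc]
  show ?thesis by (simp add: V_dev_eq_U_dev_converse var_scale_converse vimage_def)
qed

subsection \<open>Asymptotics\<close>

text \<open>The part of acceptability that is symmetric in m and n, split off so that it survives
  transposition.\<close>

definition comparable_sizes :: "real \<Rightarrow> (nat \<Rightarrow> nat) \<Rightarrow> (nat \<Rightarrow> nat) \<Rightarrow> bool" where
  "comparable_sizes \<epsilon> m n \<longleftrightarrow> filterlim m at_top sequentially \<and> filterlim n at_top sequentially \<and>
     (\<lambda>l. real (m l)) \<in> o(\<lambda>l. real (n l) powr (1 + \<epsilon>)) \<and>
     (\<lambda>l. real (n l)) \<in> o(\<lambda>l. real (m l) powr (1 + \<epsilon>))"

lemma comparable_sizes_sym: "comparable_sizes \<epsilon> m n \<Longrightarrow> comparable_sizes \<epsilon> n m"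
  by (simp add: comparable_sizes_def)

lemma eventually_ge_of_filterlim:
  fixes n :: "nat \<Rightarrow> nat"
  assumes "filterlim n at_top sequentially"
  shows "\<forall>\<^sub>F l in sequentially. n l \<ge> N"
  using assms by (simp add: filterlim_at_top)

lemma eventually_real_of_filterlim:
  assumes "filterlim n at_top sequentially" "eventually P (at_top :: real filter)"
  shows "\<forall>\<^sub>F l in sequentially. P (real (n l))"
  using assms(2) filterlim_compose[OF filterlim_real_sequentially assms(1)]
  by (rule eventually_compose_filterlim)

lemma eventually_admissible:
  assumes cs: "comparable_sizes \<epsilon> m n" and \<epsilon>: "\<epsilon> > 0" and c: "c > 0"
  shows "\<forall>\<^sub>F l in sequentially. admissible \<epsilon> c C (m l) (n l)"
proof -
  have n: "filterlim n at_top sequentially" and m: "filterlim m at_top sequentially"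
    using cs by (auto simp: comparable_sizes_def)
  have mn: "\<forall>\<^sub>F l in sequentially. real (m l) \<le> real (n l) powr (1 + \<epsilon>)"
    using landau_o.smallD[of "\<lambda>l. real (m l)" _ "\<lambda>l. real (n l) powr (1 + \<epsilon>)" 1] cs
    by (simp add: comparable_sizes_def)
  have nm: "\<forall>\<^sub>F l in sequentially. real (n l) \<le> real (m l) powr (1 + \<epsilon>)"
    using landau_o.smallD[of "\<lambda>l. real (n l)" _ "\<lambda>l. real (m l) powr (1 + \<epsilon>)" 1] cs
    by (simp add: comparable_sizes_def)
  have "eventually (\<lambda>x. (6 + 4 * C + 6 * C\<^sup>2) * ln x \<le> c * x powr (\<epsilon>/2)) at_top"
  proof -
    have "(\<lambda>x::real. (6 + 4 * C + 6 * C\<^sup>2) * ln x) \<in> o(\<lambda>x. x powr (\<epsilon>/2))"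
    proof -
      have "(\<lambda>x::real. ln x) \<in> o(\<lambda>x. x powr (\<epsilon>/2))" using \<epsilon> by real_asymp
      then show ?thesis by simp
    qed
    from landau_o.smallD[OF this c] show ?thesis by eventually_elim auto
  qed
  from eventually_real_of_filterlim[OF n this] mn nm
    eventually_ge_of_filterlim[OF m, of 3] eventually_ge_of_filterlim[OF n, of 3]
  show ?thesis by eventually_elim (simp add: admissible_def)
qed

lemma acceptable_comparable: "acceptable a \<epsilon> m n x \<Longrightarrow> comparable_sizes \<epsilon> m n"
  by (simp add: acceptable_def comparable_sizes_def)

text \<open>With u = x(1 - x) the quotient is (1 - 4u)/(4u) and its cofactor is at least 1, so 1 <
  4u (1 + a ln n), which is at most 4u (1 + a) ln n once ln n \<ge> 1.\<close>

lemma acceptable_density: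
  assumes acc: "acceptable a \<epsilon> m n x" and a: "a > 0"
  shows "\<forall>\<^sub>F l in sequentially. 0 < x l \<and> x l < 1 \<and> 1 / (4 * (1 + a)) / ln (real (n l)) \<le> x l * (1 - x l)"
proof -
  have "\<forall>\<^sub>F l in sequentially. n l \<ge> 3"
    using acc by (intro eventually_ge_of_filterlim) (simp add: acceptable_def)
  moreover have "\<forall>\<^sub>F l in sequentially. 0 < x l \<and> x l < 1 \<and>
        (1 - 2 * x l)\<^sup>2 / (4 * x l * (1 - x l)) *
          (1 + 5 * real (m l) / (6 * real (n l)) + 5 * real (n l) / (6 * real (m l)))
        < a * ln (real (n l))"
    using acc by (simp add: acceptable_def)
  ultimately show ?thesis
  proof eventually_elim
    case (elim l)
    define u where "u = x l * (1 - x l)"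
    define F where "F = 1 + 5 * real (m l) / (6 * real (n l)) + 5 * real (n l) / (6 * real (m l))"
    let ?L = "ln (real (n l))"
    have u: "u > 0" using elim by (simp add: u_def)
    have F: "F \<ge> 1" by (simp add: F_def)
    have L: "?L \<ge> 1"
    proof -
      have "exp 1 \<le> real (n l)" using exp_le elim(1) by linarith
      then show ?thesis using elim(1) by (subst ln_ge_iff) auto
    qed
    have "(1 - 2 * x l)\<^sup>2 / (4 * x l * (1 - x l)) = (1 - 4 * u) / (4 * u)"
      by (simp add: u_def power2_eq_square algebra_simps)
    moreover have "(1 - 2 * x l)\<^sup>2 / (4 * x l * (1 - x l)) \<ge> 0" using elim by simp
    ultimately have "(1 - 4 * u) / (4 * u) * 1 \<le> (1 - 4 * u) / (4 * u) * F"
      using F by (intro mult_left_mono) auto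
    also have "\<dots> < a * ?L"
      using elim \<open>_ = (1 - 4 * u) / (4 * u)\<close> by (simp add: F_def)
    finally have "1 - 4 * u < a * ?L * (4 * u)" using u by (simp add: divide_less_eq)
    then have "1 \<le> 4 * u * (1 + a * ?L)" by (simp add: algebra_simps)
    also have "\<dots> \<le> 4 * u * ((1 + a) * ?L)"
      using u L by (intro mult_left_mono) (auto simp: algebra_simps)
    also have "\<dots> = u * (4 * (1 + a) * ?L)" by simp
    finally have "1 \<le> u * (4 * (1 + a) * ?L)" .
    moreover have "4 * (1 + a) * ?L > 0" using a L by simp
    ultimately have "1 / (4 * (1 + a) * ?L) \<le> u" by (simp add: divide_le_eq)
    then show ?case using elim by (simp add: u_def)
  qed
qed

text \<open>Failure probabilities may be measured in another sequence k, in practice m, while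
  \<open>otilde\<close> always refers to n. The relation n \<le> k^2 halves the exponent on the way
  back: n^(\<epsilon>/8) \<le> k^(\<epsilon>/4).\<close>

lemma whp_of_failure_bound:
  assumes \<epsilon>: "0 < \<epsilon>" and k: "filterlim k at_top sequentially"
    and nk: "\<forall>\<^sub>F l in sequentially. real (n l) \<le> real (k l) ^ 2"
    and fail: "\<forall>\<^sub>F l in sequentially. measure_pmf.prob (D l) {G. \<not> P l G} \<le> 2 * failure_bound \<epsilon> (k l)"
  shows "whp n D P"
proof -
  have "eventually (\<lambda>x::real. 8 * x ^ 3 * exp (- (x powr (\<epsilon>/2)) / 4) \<le> exp (- (x powr (\<epsilon>/4)))) at_top"
    using \<epsilon> by real_asymp
  from eventually_real_of_filterlim[OF k this] fail nk eventually_ge_of_filterlim[OF k, of 1]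
  have "\<forall>\<^sub>F l in sequentially. norm (1 - measure_pmf.prob (D l) {G. P l G})
      \<le> 1 * norm (exp (- (real (n l) powr (\<epsilon>/8))))"
  proof eventually_elim
    case (elim l)
    have "1 - measure_pmf.prob (D l) {G. P l G} = measure_pmf.prob (D l) (UNIV - {G. P l G})"
      using measure_pmf.prob_compl[of "{G. P l G}" "D l"] by simp
    also have "UNIV - {G. P l G} = {G. \<not> P l G}" by auto
    finally have eq: "1 - measure_pmf.prob (D l) {G. P l G} = measure_pmf.prob (D l) {G. \<not> P l G}" .
    have "real (n l) powr (\<epsilon>/8) \<le> (real (k l) ^ 2) powr (\<epsilon>/8)"
      using elim \<epsilon> by (intro powr_mono2) auto
    also have "(real (k l) ^ 2) powr (\<epsilon>/8) = (real (k l) powr 2) powr (\<epsilon>/8)" using elim by simp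
    also have "\<dots> = real (k l) powr (\<epsilon>/4)" by (simp only: powr_powr) simp
    finally have "exp (- (real (k l) powr (\<epsilon>/4))) \<le> exp (- (real (n l) powr (\<epsilon>/8)))" by simp
    moreover have "2 * failure_bound \<epsilon> (k l) \<le> exp (- (real (k l) powr (\<epsilon>/4)))"
      using elim(1) by (simp add: failure_bound_def)
    ultimately have "measure_pmf.prob (D l) {G. \<not> P l G} \<le> exp (- (real (n l) powr (\<epsilon>/8)))"
      using elim(2) by linarith
    then show ?case unfolding eq by simp
  qed
  then have "(\<lambda>l. 1 - measure_pmf.prob (D l) {G. P l G}) \<in> O(\<lambda>l. exp (- (real (n l) powr (\<epsilon>/8))))"
    by (rule landau_o.bigI[rotated]) simp
  then show ?thesis unfolding whp_def otilde_def using \<epsilon> by (intro exI[of _ "\<epsilon>/8"]) auto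
qed

lemma le_square_of_admissible:
  assumes "admissible \<epsilon> c C m n" "\<epsilon> \<le> 1"
  shows "real n \<le> real m ^ 2"
proof -
  have "m \<ge> 3" using assms by (simp add: admissible_def)
  have "real n \<le> real m powr (1 + \<epsilon>)" using assms by (simp add: admissible_def)
  also have "real m powr (1 + \<epsilon>) \<le> real m powr 2"
    using \<open>m \<ge> 3\<close> assms by (intro powr_mono) auto
  finally show ?thesis using \<open>m \<ge> 3\<close> by simp
qed

lemma ln_le_of_admissible:
  assumes "admissible \<epsilon> c C m n" "\<epsilon> \<le> 1"
  shows "ln (real n) \<le> 2 * ln (real m)"
proof -
  have mn: "m \<ge> 3" "n \<ge> 3" using assms by (auto simp: admissible_def)
  then have "ln (real n) \<le> ln (real m ^ 2)" using le_square_of_admissible[OF assms] by simp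
  also have "\<dots> = 2 * ln (real m)" using mn by (simp add: ln_realpow)
  finally show ?thesis .
qed

section \<open>High-probability statements for each model\<close>

lemma exchangeable_concentrated:
  assumes \<epsilon>: "0 < \<epsilon>" "\<epsilon> \<le> 1/8" and c: "c > 0" and cs: "comparable_sizes \<epsilon> m n"
    and D: "\<forall>\<^sub>F l in sequentially. host (m l) (n l) (A l) (r l) \<and> edge_exchangeable (A l) (q l) (D l) \<and>
      0 \<le> q l \<and> q l \<le> 1 \<and> c / ln (real (n l)) \<le> q l * (1 - q l)"
  shows "U_concentrated \<epsilon> m n D" "V_concentrated \<epsilon> m n D" "m = n \<Longrightarrow> UV_small \<epsilon> n D"
proof -
  have n: "filterlim n at_top sequentially" and m: "filterlim m at_top sequentially"
    using cs by (auto simp: comparable_sizes_def)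
  \<comment> \<open>One factor 2 is asked for by \<open>exchangeable_failure\<close>; the other pays
    for ln n \<le> 2 ln m in the transposed statement.\<close>
  define d where "d = c / 4"
  have d: "d > 0" using c by (simp add: d_def)
  note adm = eventually_admissible[OF cs \<epsilon>(1) d, of 2]
  note adm' = eventually_admissible[OF comparable_sizes_sym[OF cs] \<epsilon>(1) d, of 2]
  have nn: "\<forall>\<^sub>F l in sequentially. real (n l) \<le> real (n l) ^ 2"
    using eventually_ge_of_filterlim[OF n, of 1] by eventually_elim (simp add: self_le_power)
  have nm: "\<forall>\<^sub>F l in sequentially. real (n l) \<le> real (m l) ^ 2"
    using adm
  proof eventually_elim
    case (elim l)
    then show ?case by (rule le_square_of_admissible) (use \<epsilon> in simp)
  qed
  have half: "2 * d / L \<le> c / L" if "L > 0" for L using that c by (intro divide_right_mono) (auto simp: d_def)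
  have "\<forall>\<^sub>F l in sequentially. measure_pmf.prob (D l)
      {G. \<not> \<bar>U_dev (m l) (n l) G - var_scale (m l) (n l) G\<bar>
        \<le> 1 * real (n l) powr (-1/2 + 2 * \<epsilon>) * \<bar>var_scale (m l) (n l) G\<bar>} \<le> 2 * failure_bound \<epsilon> (n l)"
    using D adm
  proof eventually_elim
    case (elim l)
    have "ln (real (n l)) > 0" using elim by (simp add: admissible_def)
    then have "2 * d / ln (real (n l)) \<le> q l * (1 - q l)" using half elim by fastforce
    then show ?case unfolding mult_1 using elim by (intro exchangeable_U_failure[OF \<epsilon> d]) auto
  qed
  from whp_of_failure_bound[OF \<epsilon>(1) n nn this] show "U_concentrated \<epsilon> m n D"
    unfolding U_concentrated_def by (intro exI[of _ 1]) auto
  have "\<forall>\<^sub>F l in sequentially. measure_pmf.prob (D l)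
      {G. \<not> \<bar>V_dev (m l) (n l) G - var_scale (m l) (n l) G\<bar>
        \<le> 1 * real (m l) powr (-1/2 + 2 * \<epsilon>) * \<bar>var_scale (m l) (n l) G\<bar>} \<le> 2 * failure_bound \<epsilon> (m l)"
    using D adm adm'
  proof eventually_elim
    case (elim l)
    have L: "ln (real (n l)) > 0" "ln (real (m l)) > 0" using elim by (auto simp: admissible_def)
    have "ln (real (n l)) \<le> 2 * ln (real (m l))" using ln_le_of_admissible elim \<epsilon> by auto
    then have "c / (2 * ln (real (m l))) \<le> c / ln (real (n l))"
      using L c by (intro divide_left_mono) auto
    then have "2 * d / ln (real (m l)) \<le> q l * (1 - q l)" using elim by (simp add: d_def)
    then show ?case unfolding mult_1 using elim by (intro exchangeable_V_failure[OF \<epsilon> d]) auto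
  qed
  from whp_of_failure_bound[OF \<epsilon>(1) m nm this] show "V_concentrated \<epsilon> m n D"
    unfolding V_concentrated_def by (intro exI[of _ 1]) auto
  show "UV_small \<epsilon> n D" if mn: "m = n"
  proof -
    have "\<forall>\<^sub>F l in sequentially. measure_pmf.prob (D l)
        {G. \<not> \<bar>UV_dev (n l) G\<bar> \<le> 1 * real (n l) powr (-1/2 + 2 * \<epsilon>) * \<bar>var_scale (n l) (n l) G\<bar>}
        \<le> 2 * failure_bound \<epsilon> (n l)"
      using D adm
    proof eventually_elim
      case (elim l)
      have "ln (real (n l)) > 0" using elim by (simp add: admissible_def)
      then have "2 * d / ln (real (n l)) \<le> q l * (1 - q l)" using half elim by fastforce
      then show ?case unfolding mult_1 using elim mn by (intro exchangeable_UV_failure[OF \<epsilon> d]) auto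
    qed
    from whp_of_failure_bound[OF \<epsilon>(1) n nn this] show ?thesis
      unfolding UV_small_def by (intro exI[of _ 1]) auto
  qed
qed

lemma model_t_concentrated:
  assumes \<epsilon>: "0 < \<epsilon>" "\<epsilon> \<le> 1/8" and c: "c > 0" and cs: "comparable_sizes \<epsilon> m n"
    and t: "\<forall>l. \<forall>j\<in>{1..n l}. t l j \<le> m l" and reg: "eps_regular \<epsilon> n (\<lambda>l j. real (t l j))"
    and l: "\<forall>\<^sub>F l in sequentially.
      0 \<le> lambda_vec (m l) (n l) (t l) \<and> lambda_vec (m l) (n l) (t l) \<le> 1 \<and>
      c / ln (real (n l)) \<le> lambda_vec (m l) (n l) (t l) * (1 - lambda_vec (m l) (n l) (t l))"
    and A: "\<forall>\<^sub>F l in sequentially. host (m l) (n l) (A l) (r l)"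
  shows "U_concentrated \<epsilon> m n (\<lambda>l. model_t (A l) (n l) (t l))"
    and "m = n \<Longrightarrow> UV_small \<epsilon> n (\<lambda>l. model_t (A l) (n l) (t l))"
proof -
  have n: "filterlim n at_top sequentially" using cs by (auto simp: comparable_sizes_def)
  obtain C0 where C0: "\<forall>\<^sub>F l in sequentially. \<forall>j\<in>{1..n l}.
      \<bar>real (t l j) - (\<Sum>j=1..n l. real (t l j)) / real (n l)\<bar> \<le> C0 * real (n l) powr (1/2 + \<epsilon>)"
    using reg unfolding eps_regular_def by blast
  \<comment> \<open>The constant in \<open>eps_regular\<close> may have any sign.\<close>
  define C where "C = max C0 1"
  have C: "C > 0" by (simp add: C_def)
  note adm = eventually_admissible[OF cs \<epsilon>(1) c, of C]
  have nn: "\<forall>\<^sub>F l in sequentially. real (n l) \<le> real (n l) ^ 2"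
    using eventually_ge_of_filterlim[OF n, of 1] by eventually_elim (simp add: self_le_power)
  have good: "\<forall>\<^sub>F l in sequentially. \<forall>j\<in>{1..n l}. t l j \<le> r l \<and>
      \<bar>real (t l j) - real (m l) * lambda_vec (m l) (n l) (t l)\<bar> \<le> C * real (n l) powr (1/2 + \<epsilon>)"
    using C0 adm l A
  proof eventually_elim
    case (elim l)
    let ?x = "real (n l)" and ?lam = "lambda_vec (m l) (n l) (t l)"
    have mn: "m l \<ge> 3" "n l \<ge> 3" using elim by (auto simp: admissible_def)
    have dev: "\<bar>real (t l j) - real (m l) * ?lam\<bar> \<le> C * ?x powr (1/2 + \<epsilon>)" if j: "j \<in> {1..n l}" for j
    proof -
      have "real (m l) * ?lam = (\<Sum>j=1..n l. real (t l j)) / ?x"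
        using mn by (simp add: lambda_vec_def)
      then have "\<bar>real (t l j) - real (m l) * ?lam\<bar> \<le> C0 * ?x powr (1/2 + \<epsilon>)" using elim j by simp
      also have "\<dots> \<le> C * ?x powr (1/2 + \<epsilon>)" by (intro mult_right_mono) (auto simp: C_def)
      finally show ?thesis .
    qed
    \<comment> \<open>Without the diagonal a column of degree n would leave no graph at all, and the
      hypothesis only gives t_j \<le> n. It is ruled out eventually: t_j exceeds n \<Lambda> by at
      most C n^(1/2 + \<epsilon>) < c n / ln n \<le> (1 - \<Lambda>) n.\<close>
    have "t l j \<le> r l" if j: "j \<in> {1..n l}" for j
    proof (cases "r l = m l")
      case True
      then show ?thesis using t j by simp
    next
      case False
      then have h: "m l = n l" "r l = n l - 1" using elim by (auto simp: host_def)
      have L: "ln ?x > 0" using mn by simp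
      have "C * ?x powr (1/2 + \<epsilon>) * ln ?x < (6 + 4 * C + 6 * C\<^sup>2) * ?x powr (1/2 + \<epsilon>) * ln ?x"
        using mn L C by (intro mult_strict_right_mono) (auto intro: add_pos_nonneg add_strict_mono)
      also have "\<dots> = ?x powr (1/2 + \<epsilon>) * ((6 + 4 * C + 6 * C\<^sup>2) * ln ?x)" by simp
      also have "\<dots> \<le> ?x powr (1/2 + \<epsilon>) * (c * ?x powr (\<epsilon>/2))"
        using elim by (intro mult_left_mono) (auto simp: admissible_def)
      also have "\<dots> = c * ?x powr (1/2 + \<epsilon> + \<epsilon>/2)"
        unfolding powr_add[of _ "1/2 + \<epsilon>"] by simp
      also have "\<dots> \<le> c * ?x powr 1" using c mn \<epsilon> by (intro mult_left_mono powr_mono) auto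
      also have "\<dots> = c * ?x" using mn by simp
      finally have 1: "C * ?x powr (1/2 + \<epsilon>) < c / ln ?x * ?x" using L by (simp add: field_simps)
      have "c / ln ?x \<le> ?lam * (1 - ?lam)" using elim by simp
      also have "\<dots> \<le> 1 * (1 - ?lam)" using elim by (intro mult_right_mono) auto
      finally have "c / ln ?x * ?x \<le> (1 - ?lam) * ?x" by (intro mult_right_mono) auto
      then have "real (t l j) < ?x" using 1 dev[OF j] h by (simp add: algebra_simps)
      then show ?thesis using h by simp
    qed
    then show ?case using dev by blast
  qed
  have f0: "failure_bound \<epsilon> k \<ge> 0" for k by (simp add: failure_bound_def)
  have "\<forall>\<^sub>F l in sequentially. measure_pmf.prob (model_t (A l) (n l) (t l))
      {G. \<not> \<bar>U_dev (m l) (n l) G - var_scale (m l) (n l) G\<bar>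
        \<le> 1 * real (n l) powr (-1/2 + 2 * \<epsilon>) * \<bar>var_scale (m l) (n l) G\<bar>} \<le> 2 * failure_bound \<epsilon> (n l)"
    using good adm l A
  proof eventually_elim
    case (elim l)
    have "measure_pmf.prob (model_t (A l) (n l) (t l))
      {G. \<not> \<bar>U_dev (m l) (n l) G - var_scale (m l) (n l) G\<bar>
        \<le> real (n l) powr (-1/2 + 2 * \<epsilon>) * \<bar>var_scale (m l) (n l) G\<bar>} \<le> failure_bound \<epsilon> (n l)"
      using elim by (intro model_t_U_failure[OF \<epsilon> c C]) auto
    then show ?case unfolding mult_1 using f0[of "n l"] by linarith
  qed
  from whp_of_failure_bound[OF \<epsilon>(1) n nn this]
  show "U_concentrated \<epsilon> m n (\<lambda>l. model_t (A l) (n l) (t l))"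
    unfolding U_concentrated_def by (intro exI[of _ 1]) auto
  show "UV_small \<epsilon> n (\<lambda>l. model_t (A l) (n l) (t l))" if mn: "m = n"
  proof -
    have "\<forall>\<^sub>F l in sequentially. measure_pmf.prob (model_t (A l) (n l) (t l))
        {G. \<not> \<bar>UV_dev (n l) G\<bar> \<le> 1 * real (n l) powr (-1/2 + 2 * \<epsilon>) * \<bar>var_scale (n l) (n l) G\<bar>}
        \<le> 2 * failure_bound \<epsilon> (n l)"
      using good adm l A
    proof eventually_elim
      case (elim l)
      have "measure_pmf.prob (model_t (A l) (n l) (t l))
        {G. \<not> \<bar>UV_dev (n l) G\<bar> \<le> real (n l) powr (-1/2 + 2 * \<epsilon>) * \<bar>var_scale (n l) (n l) G\<bar>}
        \<le> failure_bound \<epsilon> (n l)"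
        using elim mn by (intro model_t_UV_failure[OF \<epsilon> c C]) auto
      then show ?case unfolding mult_1 using f0[of "n l"] by linarith
    qed
    from whp_of_failure_bound[OF \<epsilon>(1) n nn this] show ?thesis
      unfolding UV_small_def by (intro exI[of _ 1]) auto
  qed
qed

lemma host_all_edges: "host m n (all_edges m n) m"
  and host_offdiag_edges: "host n n (offdiag_edges n) (n - 1)"
  by (auto simp: host_def)

lemma model_p_concentrated:
  assumes a: "a > 0" and \<epsilon>: "0 < \<epsilon>" "\<epsilon> \<le> 1/8" and acc: "acceptable a \<epsilon> m n p"
    and A: "\<And>l. host (m l) (n l) (A l) (r l)"
  defines "D \<equiv> \<lambda>l. model_p (A l) (p l)"
  shows "U_concentrated \<epsilon> m n D" "V_concentrated \<epsilon> m n D" "m = n \<Longrightarrow> UV_small \<epsilon> n D"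
proof -
  have c: "1 / (4 * (1 + a)) > 0" using a by simp
  have "\<forall>\<^sub>F l in sequentially. host (m l) (n l) (A l) (r l) \<and> edge_exchangeable (A l) (p l) (D l) \<and>
      0 \<le> p l \<and> p l \<le> 1 \<and> 1 / (4 * (1 + a)) / ln (real (n l)) \<le> p l * (1 - p l)"
    using acceptable_density[OF acc a]
  proof eventually_elim
    case (elim l)
    then show ?case
      using A finite_host[OF A] edge_exchangeable_model_p[of "A l" "p l"] by (auto simp: D_def)
  qed
  note * = exchangeable_concentrated[OF \<epsilon> c acceptable_comparable[OF acc] this]
  show "U_concentrated \<epsilon> m n D" "V_concentrated \<epsilon> m n D" "m = n \<Longrightarrow> UV_small \<epsilon> n D"
    using * by auto
qed

text \<open>Acceptability speaks of p = k/(mn), exchangeability of q = k / card A. Without the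
  diagonal q exceeds p by at most 2/n, which is eventually below half of the lower bound c / ln n on
  p (1 - p); hence c/2. The same margin gives q \<le> 1, and with it k \<le> card A, so that the
  model is meaningful.\<close>

lemma model_k_concentrated:
  assumes a: "a > 0" and \<epsilon>: "0 < \<epsilon>" "\<epsilon> \<le> 1/8"
    and acc: "acceptable a \<epsilon> m n (\<lambda>l. real (k l) / (real (m l) * real (n l)))"
    and A: "\<And>l. host (m l) (n l) (A l) (r l)"
  defines "D \<equiv> \<lambda>l. model_k (A l) (k l)"
  shows "U_concentrated \<epsilon> m n D" "V_concentrated \<epsilon> m n D" "m = n \<Longrightarrow> UV_small \<epsilon> n D"
proof -
  define c where "c = 1 / (4 * (1 + a))"
  have c: "c > 0" using a by (simp add: c_def)
  have c2: "c / 2 > 0" using c by simp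
  have cs: "comparable_sizes \<epsilon> m n" by (rule acceptable_comparable[OF acc])
  have m: "filterlim m at_top sequentially" using cs by (simp add: comparable_sizes_def)
  have n: "filterlim n at_top sequentially" using cs by (simp add: comparable_sizes_def)
  have "eventually (\<lambda>x::real. 2 / x < c / 2 / ln x) at_top" using c by real_asymp
  from eventually_real_of_filterlim[OF n this] acceptable_density[OF acc a]
    eventually_ge_of_filterlim[OF m, of 3] eventually_ge_of_filterlim[OF n, of 3]
  have "\<forall>\<^sub>F l in sequentially. host (m l) (n l) (A l) (r l) \<and>
      edge_exchangeable (A l) (real (k l) / real (card (A l))) (D l) \<and>
      0 \<le> real (k l) / real (card (A l)) \<and> real (k l) / real (card (A l)) \<le> 1 \<and>
      c / 2 / ln (real (n l)) \<le> real (k l) / real (card (A l)) * (1 - real (k l) / real (card (A l)))"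
  proof eventually_elim
    case (elim l)
    let ?x = "real (n l)"
    define p where "p = real (k l) / (real (m l) * ?x)"
    define q where "q = real (k l) / real (card (A l))"
    have mn: "real (m l) \<ge> 3" "?x \<ge> 3" "m l \<ge> 2" using elim by auto
    note r = host_bounds[OF A mn(3)]
    have card: "real (card (A l)) = ?x * real (r l)" using card_host[OF A] by simp
    have L: "ln ?x > 0" using mn by simp
    have p: "0 < p" "p < 1" "c / ln ?x \<le> p * (1 - p)" using elim by (auto simp: p_def c_def)
    have small: "2 / ?x < c / 2 / ln ?x" using elim by simp
    have rm: "r l = m l \<or> m l = n l" using A[of l] by (auto simp: host_def)
    have pq: "q * real (r l) = p * real (m l)"
      using mn r by (simp add: p_def q_def card)
    have mr: "(real (m l) - real (r l)) / real (r l) \<le> 2 / ?x"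
    proof (cases "r l = m l")
      case True
      then show ?thesis by simp
    next
      case False
      then have "real (m l) = ?x" using rm by simp
      then have "(real (m l) - real (r l)) / real (r l) \<le> 1 / (?x / 2)"
        using r mn by (intro frac_le) auto
      then show ?thesis by simp
    qed
    have qp: "q - p = p * ((real (m l) - real (r l)) / real (r l))"
    proof -
      have "q = p * real (m l) / real (r l)" using pq r by (simp add: eq_divide_eq)
      then show ?thesis using r by (simp add: diff_divide_distrib right_diff_distrib)
    qed
    have qp0: "q \<ge> p" "q - p \<le> 2 / ?x"
    proof -
      have "p * ((real (m l) - real (r l)) / real (r l)) \<le> 1 * (2 / ?x)"
        using p mr r by (intro mult_mono) auto
      then show "q - p \<le> 2 / ?x" using qp by simp
      have "0 \<le> p * ((real (m l) - real (r l)) / real (r l))" using p r by simp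
      then show "q \<ge> p" using qp by simp
    qed
    have q1: "q \<le> 1"
    proof -
      have "2 / ?x \<le> c / 2 / ln ?x" using small by simp
      also have "\<dots> \<le> c / ln ?x" using c L by (simp add: field_simps)
      also have "\<dots> \<le> p * (1 - p)" by (rule p(3))
      also have "\<dots> \<le> 1 * (1 - p)" using p by (intro mult_right_mono) auto
      finally have "q - p \<le> 1 * (1 - p)" by (rule order_trans[OF qp0(2)])
      then show ?thesis by simp
    qed
    have q0: "0 \<le> q" by (simp add: q_def)
    have kA: "k l \<le> card (A l)"
    proof -
      have "real (card (A l)) > 0" using card mn r by simp
      then show ?thesis using q1 by (simp add: q_def)
    qed
    have "c / 2 / ln ?x \<le> q * (1 - q)"
    proof -
      have "\<bar>q * (1 - q) - p * (1 - p)\<bar> \<le> \<bar>q - p\<bar>"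
        using p q0 q1 by (intro abs_diff_variance_le) auto
      moreover have "c / ln ?x = c / 2 / ln ?x + c / 2 / ln ?x" by (simp add: field_simps)
      moreover have "\<bar>q - p\<bar> \<le> c / 2 / ln ?x"
      proof -
        have "q - p \<le> c / 2 / ln ?x" by (rule order_trans[OF qp0(2) less_imp_le[OF small]])
        then show ?thesis using qp0(1) by simp
      qed
      ultimately show ?thesis using p(3) by linarith
    qed
    then show ?case
      using A q0 q1 edge_exchangeable_model_k[OF finite_host[OF A] kA] unfolding D_def q_def by auto
  qed
  note * = exchangeable_concentrated[OF \<epsilon> c2 cs this]
  show "U_concentrated \<epsilon> m n D" "V_concentrated \<epsilon> m n D" "m = n \<Longrightarrow> UV_small \<epsilon> n D"
    using * by auto
qed

lemma model_t_acceptable_concentrated: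
  assumes a: "a > 0" and \<epsilon>: "0 < \<epsilon>" "\<epsilon> \<le> 1/8"
    and acc: "acceptable a \<epsilon> m n (\<lambda>l. lambda_vec (m l) (n l) (t l))"
    and t: "\<forall>l. \<forall>j\<in>{1..n l}. t l j \<le> m l" and reg: "eps_regular \<epsilon> n (\<lambda>l j. real (t l j))"
    and A: "\<And>l. host (m l) (n l) (A l) (r l)"
  shows "U_concentrated \<epsilon> m n (\<lambda>l. model_t (A l) (n l) (t l))"
    and "m = n \<Longrightarrow> UV_small \<epsilon> n (\<lambda>l. model_t (A l) (n l) (t l))"
proof -
  have c: "1 / (4 * (1 + a)) > 0" using a by simp
  have l: "\<forall>\<^sub>F l in sequentially.
      0 \<le> lambda_vec (m l) (n l) (t l) \<and> lambda_vec (m l) (n l) (t l) \<le> 1 \<and>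
      1 / (4 * (1 + a)) / ln (real (n l)) \<le> lambda_vec (m l) (n l) (t l) * (1 - lambda_vec (m l) (n l) (t l))"
    using acceptable_density[OF acc a] by eventually_elim auto
  have ev: "\<forall>\<^sub>F l in sequentially. host (m l) (n l) (A l) (r l)" using A by simp
  note * = model_t_concentrated[OF \<epsilon> c acceptable_comparable[OF acc] t reg l ev]
  show "U_concentrated \<epsilon> m n (\<lambda>l. model_t (A l) (n l) (t l))"
    and "m = n \<Longrightarrow> UV_small \<epsilon> n (\<lambda>l. model_t (A l) (n l) (t l))"
    using * by auto
qed

theorem theorem2p5:
  fixes a :: real
  assumes "a > 0"
  shows "\<exists>\<epsilon>\<^sub>0>0. \<forall>\<epsilon>::real. 0 < \<epsilon> \<and> \<epsilon> < \<epsilon>\<^sub>0 \<longrightarrow>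
    (\<forall>(m :: nat \<Rightarrow> nat) (n :: nat \<Rightarrow> nat) (p :: nat \<Rightarrow> real) (k :: nat \<Rightarrow> nat).
       acceptable a \<epsilon> m n p \<and>
       acceptable a \<epsilon> m n (\<lambda>l. real (k l) / (real (m l) * real (n l))) \<longrightarrow>
         (\<forall>D \<in> {\<lambda>l. model_p (all_edges (m l) (n l)) (p l),
                \<lambda>l. model_k (all_edges (m l) (n l)) (k l)}.
            U_concentrated \<epsilon> m n D \<and> V_concentrated \<epsilon> m n D) \<and>
         (m = n \<longrightarrow>
           (\<forall>D \<in> {\<lambda>l. model_p (offdiag_edges (n l)) (p l),
                  \<lambda>l. model_k (offdiag_edges (n l)) (k l)}.
              U_concentrated \<epsilon> m n D \<and> V_concentrated \<epsilon> m n D))) \<and>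
    (\<forall>(m :: nat \<Rightarrow> nat) (n :: nat \<Rightarrow> nat) (t :: nat \<Rightarrow> nat \<Rightarrow> nat).
       (\<forall>l. \<forall>j\<in>{1..n l}. t l j \<le> m l) \<and>
       eps_regular \<epsilon> n (\<lambda>l j. real (t l j)) \<and>
       acceptable a \<epsilon> m n (\<lambda>l. lambda_vec (m l) (n l) (t l)) \<longrightarrow>
         U_concentrated \<epsilon> m n (\<lambda>l. model_t (all_edges (m l) (n l)) (n l) (t l)) \<and>
         (m = n \<longrightarrow>
           U_concentrated \<epsilon> m n (\<lambda>l. model_t (offdiag_edges (n l)) (n l) (t l)))) \<and>
    (\<forall>(n :: nat \<Rightarrow> nat) (p :: nat \<Rightarrow> real) (k :: nat \<Rightarrow> nat) (t :: nat \<Rightarrow> nat \<Rightarrow> nat).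
       acceptable a \<epsilon> n n p \<and>
       acceptable a \<epsilon> n n (\<lambda>l. real (k l) / (real (n l))\<^sup>2) \<and>
       acceptable a \<epsilon> n n (\<lambda>l. lambda_vec (n l) (n l) (t l)) \<and>
       (\<forall>l. \<forall>j\<in>{1..n l}. t l j \<le> n l) \<and>
       eps_regular \<epsilon> n (\<lambda>l j. real (t l j)) \<longrightarrow>
         (\<forall>D \<in> {\<lambda>l. model_p (offdiag_edges (n l)) (p l),
                \<lambda>l. model_k (offdiag_edges (n l)) (k l),
                \<lambda>l. model_t (offdiag_edges (n l)) (n l) (t l)}.
            UV_small \<epsilon> n D))"
proof (intro exI[of _ "1/8 :: real"] conjI allI impI)
  show "(0 :: real) < 1/8" by simp
next
  fix \<epsilon> :: real and m n :: "nat \<Rightarrow> nat" and p :: "nat \<Rightarrow> real" and k :: "nat \<Rightarrow> nat"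
    and D :: "nat \<Rightarrow> bigraph pmf"
  assume \<epsilon>: "0 < \<epsilon> \<and> \<epsilon> < 1/8"
    and acc: "acceptable a \<epsilon> m n p \<and> acceptable a \<epsilon> m n (\<lambda>l. real (k l) / (real (m l) * real (n l)))"
  have \<epsilon>': "0 < \<epsilon>" "\<epsilon> \<le> 1/8" using \<epsilon> by auto
  note P = model_p_concentrated[OF assms \<epsilon>' conjunct1[OF acc]]
  note K = model_k_concentrated[OF assms \<epsilon>' conjunct2[OF acc]]
  show "\<forall>D \<in> {\<lambda>l. model_p (all_edges (m l) (n l)) (p l), \<lambda>l. model_k (all_edges (m l) (n l)) (k l)}.
      U_concentrated \<epsilon> m n D \<and> V_concentrated \<epsilon> m n D"
    using P(1,2)[of "\<lambda>l. all_edges (m l) (n l)" m, OF host_all_edges]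
      K(1,2)[of "\<lambda>l. all_edges (m l) (n l)" m, OF host_all_edges] by simp
  assume mn: "m = n"
  have "\<And>l. host (m l) (n l) (offdiag_edges (n l)) (n l - 1)"
    unfolding mn by (rule host_offdiag_edges)
  then show "\<forall>D \<in> {\<lambda>l. model_p (offdiag_edges (n l)) (p l), \<lambda>l. model_k (offdiag_edges (n l)) (k l)}.
      U_concentrated \<epsilon> m n D \<and> V_concentrated \<epsilon> m n D"
    using P(1,2)[of "\<lambda>l. offdiag_edges (n l)" "\<lambda>l. n l - 1"]
      K(1,2)[of "\<lambda>l. offdiag_edges (n l)" "\<lambda>l. n l - 1"] by simp
next
  fix \<epsilon> :: real and m n :: "nat \<Rightarrow> nat" and t :: "nat \<Rightarrow> nat \<Rightarrow> nat"
  assume \<epsilon>: "0 < \<epsilon> \<and> \<epsilon> < 1/8"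
    and h: "(\<forall>l. \<forall>j\<in>{1..n l}. t l j \<le> m l) \<and> eps_regular \<epsilon> n (\<lambda>l j. real (t l j)) \<and>
      acceptable a \<epsilon> m n (\<lambda>l. lambda_vec (m l) (n l) (t l))"
  have \<epsilon>': "0 < \<epsilon>" "\<epsilon> \<le> 1/8" using \<epsilon> by auto
  have acc: "acceptable a \<epsilon> m n (\<lambda>l. lambda_vec (m l) (n l) (t l))"
    and t: "\<forall>l. \<forall>j\<in>{1..n l}. t l j \<le> m l" and reg: "eps_regular \<epsilon> n (\<lambda>l j. real (t l j))"
    using h by auto
  show "U_concentrated \<epsilon> m n (\<lambda>l. model_t (all_edges (m l) (n l)) (n l) (t l))"
    by (rule model_t_acceptable_concentrated(1)[OF assms \<epsilon>' acc t reg host_all_edges])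
  assume mn: "m = n"
  have "\<And>l. host (m l) (n l) (offdiag_edges (n l)) (n l - 1)"
    unfolding mn by (rule host_offdiag_edges)
  then show "U_concentrated \<epsilon> m n (\<lambda>l. model_t (offdiag_edges (n l)) (n l) (t l))"
    by (rule model_t_acceptable_concentrated(1)[OF assms \<epsilon>' acc t reg])
next
  fix \<epsilon> :: real and n :: "nat \<Rightarrow> nat" and p :: "nat \<Rightarrow> real" and k :: "nat \<Rightarrow> nat"
    and t :: "nat \<Rightarrow> nat \<Rightarrow> nat"
  assume \<epsilon>: "0 < \<epsilon> \<and> \<epsilon> < 1/8"
    and h: "acceptable a \<epsilon> n n p \<and> acceptable a \<epsilon> n n (\<lambda>l. real (k l) / (real (n l))\<^sup>2) \<and>
      acceptable a \<epsilon> n n (\<lambda>l. lambda_vec (n l) (n l) (t l)) \<and>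
      (\<forall>l. \<forall>j\<in>{1..n l}. t l j \<le> n l) \<and> eps_regular \<epsilon> n (\<lambda>l j. real (t l j))"
  have \<epsilon>': "0 < \<epsilon>" "\<epsilon> \<le> 1/8" using \<epsilon> by auto
  have acc: "acceptable a \<epsilon> n n p" "acceptable a \<epsilon> n n (\<lambda>l. real (k l) / (real (n l) * real (n l)))"
      "acceptable a \<epsilon> n n (\<lambda>l. lambda_vec (n l) (n l) (t l))"
    and t: "\<forall>l. \<forall>j\<in>{1..n l}. t l j \<le> n l" and reg: "eps_regular \<epsilon> n (\<lambda>l j. real (t l j))"
    using h by (auto simp: power2_eq_square)
  show "\<forall>D \<in> {\<lambda>l. model_p (offdiag_edges (n l)) (p l), \<lambda>l. model_k (offdiag_edges (n l)) (k l),
      \<lambda>l. model_t (offdiag_edges (n l)) (n l) (t l)}. UV_small \<epsilon> n D"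
    using model_p_concentrated(3)[OF assms \<epsilon>' acc(1) host_offdiag_edges refl]
      model_k_concentrated(3)[OF assms \<epsilon>' acc(2) host_offdiag_edges refl]
      model_t_acceptable_concentrated(2)[OF assms \<epsilon>' acc(3) t reg host_offdiag_edges refl]
    by simp
qed

end
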